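(* Let $a,d$ be positive integers and let $\mathscr T=(V,\mathcal E)$ be the directed Cartesian product of locally finite rooted directed trees $\mathscr T_1,\ldots,\mathscr T_d$, of finite joint branching index. Then the Drury-Arveson-type Hilbert module $\mathscr H_{\mathfrak c_a}(\mathscr T)$ associated with $\mathscr T$ is isomorphic to the classical Drury-Arveson-type Hilbert module $\mathscr H_a$ if and only if for every $j=1,\ldots,d$, the directed tree $\mathscr T_j$ is graph isomorphic to the rooted directed tree without any branching vertex.
   Context: Conventions: $\mathbb N=\{0,1,2,\ldots\}$; for $\alpha\in\mathbb N^d$, $\alpha!=\prod_j\alpha_j!$ and $|\alpha|=\sum_j\alpha_j$; empty sums are $0$, empty products are $1$. $\mathscr P$ is the set of all subsets of $\{1,\ldots,d\}$. $\mathbb B^d$ is the open unit ball of $\mathbb C^d$. Trees: a rooted directed tree is a connected directed graph without circuits in which every vertex has at most one parent and exactly one vertex (the root) has no parent. $\mathsf{Chi}(u)$ is the set of children of $u$; for a non-root $u$, $\mathsf{par}(u)$ is its parent and $\mathsf{sib}(u)=\mathsf{Chi}(\mathsf{par}(u))$ (so $u\in\mathsf{sib}(u)$). All directed trees are assumed countably infinite and leafless ($\mathrm{card}(\mathsf{Chi}(u))\geq 1$ for all $u$). Locally finite: every $\mathsf{Chi}(u)$ is finite. A branching vertex of a tree is a vertex with at least two children. The depth of $u$ is the length of the path from the root to $u$. Two directed graphs are (graph) isomorphic if there is a bijection between their vertex sets preserving directed edges (in both directions). The (leafless) rooted directed tree without branching vertex is, up to isomorphism, $\mathbb N$ with edges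 $(n,n+1)$. Products: for rooted directed trees $\mathscr T_j=(V_j,\mathcal E_j)$ with roots $\mathsf{root}_j$, the directed Cartesian product $\mathscr T=(V,\mathcal E)$ has $V=V_1\times\cdots\times V_d$ and $(v,w)\in\mathcal E$ iff there is $k$ with $v_j=w_j$ for $j\neq k$ and $(v_k,w_k)\in\mathcal E_k$. Put $\mathsf{root}=(\mathsf{root}_1,\ldots,\mathsf{root}_d)$. The depth of $v\in V$ is $\mathsf d_v=(\mathsf d_{v_1},\ldots,\mathsf d_{v_d})$ with $\mathsf d_{v_j}$ the depth of $v_j$ in $\mathscr T_j$. $\mathsf{Chi}_j(v)$ (resp. $\mathsf{sib}_j(v)$, for $v_j\neq\mathsf{root}_j$) is the set of $w\in V$ with $w_i=v_i$ for $i\ne j$ and $w_j\in\mathsf{Chi}(v_j)$ (resp. $w_j\in\mathsf{sib}(v_j)$). $\mathscr T$ is of finite joint branching index if, for each $j$, the set of depths of the branching vertices of $\mathscr T_j$ is bounded (possibly empty). Weights: for $a>0$, let $\lambda_j(w)=\frac{1}{\sqrt{\mathrm{card}(\mathsf{Chi}_j(v))}}\sqrt{\frac{\mathsf d_{v_j}+1}{|\mathsf d_v|+a}}$ for $w\in\mathsf{Chi}_j(v)$, $v\in V$, $j=1,\ldots,d$. On $l^2(V)$ with orthonormal basis $\{e_v\}_{v\in V}$ of indicator functions, the Drury-Arveson-type multishift is the commuting $d$-tuple $(S_1,\ldots,S_d)$ with $S_je_v=\sum_{w\in\mathsf{Chi}_j(v)}\lambda_j(w)e_w$. Spaces $\mathcal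 L_{u,F}$: for $F\in\mathscr P$ let $\Phi_F=\{v\in V: v_j\neq\mathsf{root}_j\text{ if }j\in F,\ v_j=\mathsf{root}_j\text{ if }j\notin F\}$. For $u\in\Phi_F$, $\mathsf{sib}_F(u)$ is the set of $w\in V$ with $w_j\in\mathsf{sib}(u_j)$ for $j\in F$ and $w_j=u_j$ for $j\notin F$. These sets partition $\Phi_F$, and $\Omega_F$ is any set containing exactly one element of each class. For $G\in\mathscr P$, $v_G$ is $v$ with all coordinates $v_j$, $j\notin G$, replaced by $\mathsf{root}_j$; $\mathsf{sib}_{F,G}(u)=\{v_G: v\in\mathsf{sib}_F(u)\}$ for $G\subseteq F$; for $j\notin G$, $v_G|u_j$ is $v_G$ with $j$-th coordinate replaced by $u_j$. $\mathcal L_{u,F}\subseteq l^2(\mathsf{sib}_F(u))$ is the space of $f$ with $\sum_{w\in\mathsf{sib}_j(v_G|u_j)}f(w)\lambda_j(w)=0$ for all $j\in F$, $G=F\setminus\{j\}$, $v_G\in\mathsf{sib}_{F,G}(u)$ ($\mathcal L_{\mathsf{root},\emptyset}$ is the span of $e_{\mathsf{root}}$). The joint kernel $E=\bigcap_j\ker S_j^*$ equals $\bigoplus_{F\in\mathscr P}\bigoplus_{u\in\Omega_F}\mathcal L_{u,F}$ and is finite dimensional when $\mathscr T$ is of finite joint branching index. Hilbert modules: for $\mathscr T$ of finite joint branching index, $\mathscr H_{\mathfrak c_a}(\mathscr T)$ is the reproducing kernel Hilbert space of $E$-valued holomorphic functions on $\mathbb B^d$ with $B(E)$-valued kernel $$\kappa(z,w)=\sum_{F\in\mathscr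 P}\sum_{u\in\Omega_F}\Big(\sum_{\alpha\in\mathbb N^d}\frac{\mathsf d_u!}{(\mathsf d_u+\alpha)!}\prod_{i=0}^{|\alpha|-1}(|\mathsf d_u|+a+i)\,z^\alpha\overline w^\alpha\Big)P_{\mathcal L_{u,F}},$$ $P_{\mathcal L_{u,F}}$ being the orthogonal projection of $E$ onto $\mathcal L_{u,F}$. $\mathscr H_a$ is the reproducing kernel Hilbert space of scalar holomorphic functions on $\mathbb B^d$ with kernel $\kappa_a(z,w)=(1-\langle z,w\rangle)^{-a}$. Both are modules over $\mathbb C[z_1,\ldots,z_d]$ through $p\cdot h=p(\mathscr M_z)h$, with $\mathscr M_z$ the $d$-tuple of (bounded) multiplications by coordinate functions. Two such modules are isomorphic if there is a unitary between them intertwining the multiplication operators $\mathscr M_{z_k}$ for all $k=1,\ldots,d$. *)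

theory Defs
  imports "HOL-Analysis.Analysis" "HOL-Library.Function_Algebras"
begin

class complex_vector = ab_group_add +
  fixes scaleC :: "complex \<Rightarrow> 'a \<Rightarrow> 'a"  (infixr "*\<^sub>C" 75)
  assumes scaleC_add_right: "c *\<^sub>C (x + y) = c *\<^sub>C x + c *\<^sub>C y"
    and scaleC_add_left: "(b + c) *\<^sub>C x = b *\<^sub>C x + c *\<^sub>C x"
    and scaleC_scaleC: "b *\<^sub>C c *\<^sub>C x = (b * c) *\<^sub>C x"
    and scaleC_one: "1 *\<^sub>C x = x"

instantiation complex :: complex_vector
begin
definition scaleC_complex :: "complex \<Rightarrow> complex \<Rightarrow> complex"
  where "scaleC_complex c x = c * x"
instance
  by standard (simp_all add: scaleC_complex_def algebra_simps)
end

instantiation "fun" :: (type, complex_vector) complex_vector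
begin
definition scaleC_fun :: "complex \<Rightarrow> ('a \<Rightarrow> 'b) \<Rightarrow> 'a \<Rightarrow> 'b"
  where "scaleC_fun c f = (\<lambda>x. c *\<^sub>C f x)"
instance
  by standard
    (simp_all add: scaleC_fun_def plus_fun_def fun_eq_iff
      scaleC_add_right scaleC_add_left scaleC_scaleC scaleC_one)
end

text \<open>The inner product is linear in the first argument. The vector space operations
  are those of the ambient type.\<close>

record 'a hilbert =
  vecs :: "'a set"
  ip :: "'a \<Rightarrow> 'a \<Rightarrow> complex"

definition hnorm :: "'a hilbert \<Rightarrow> 'a \<Rightarrow> real"
  where "hnorm H f = sqrt (Re (ip H f f))"

definition hilbert_space :: "'a::complex_vector hilbert \<Rightarrow> bool"
  where "hilbert_space H \<longleftrightarrow>
    0 \<in> vecs H \<and>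
    (\<forall>f\<in>vecs H. \<forall>g\<in>vecs H. f + g \<in> vecs H) \<and>
    (\<forall>c. \<forall>f\<in>vecs H. c *\<^sub>C f \<in> vecs H) \<and>
    (\<forall>f\<in>vecs H. \<forall>g\<in>vecs H. \<forall>h\<in>vecs H. ip H (f + g) h = ip H f h + ip H g h) \<and>
    (\<forall>c. \<forall>f\<in>vecs H. \<forall>g\<in>vecs H. ip H (c *\<^sub>C f) g = c * ip H f g) \<and>
    (\<forall>f\<in>vecs H. \<forall>g\<in>vecs H. ip H g f = cnj (ip H f g)) \<and>
    (\<forall>f\<in>vecs H. f \<noteq> 0 \<longrightarrow> 0 < Re (ip H f f)) \<and>
    (\<forall>X. (\<forall>n::nat. X n \<in> vecs H) \<and>
         (\<forall>e>0. \<exists>N. \<forall>m\<ge>N. \<forall>n\<ge>N. hnorm H (X m - X n) < e) \<longrightarrow>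
         (\<exists>f\<in>vecs H. (\<lambda>n. hnorm H (X n - f)) \<longlonglongrightarrow> 0))"

definition hilbert_adjoint :: "'a hilbert \<Rightarrow> ('a \<Rightarrow> 'a) \<Rightarrow> 'a \<Rightarrow> 'a"
  where "hilbert_adjoint H A g =
    (THE h. h \<in> vecs H \<and> (\<forall>f\<in>vecs H. ip H (A f) g = ip H f h))"

definition orth_proj :: "'a::complex_vector hilbert \<Rightarrow> 'a set \<Rightarrow> 'a \<Rightarrow> 'a"
  where "orth_proj H L x = (THE p. p \<in> L \<and> (\<forall>y\<in>L. ip H (x - p) y = 0))"

definition complex_hilbert :: "complex hilbert"
  where "complex_hilbert = \<lparr>vecs = UNIV, ip = (\<lambda>x y. x * cnj y)\<rparr>"

definition l2 :: "'x set \<Rightarrow> ('x \<Rightarrow> complex) hilbert"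
  where "l2 X = \<lparr>
    vecs = {f. (\<forall>x. x \<notin> X \<longrightarrow> f x = 0) \<and> (\<lambda>x. (cmod (f x))\<^sup>2) summable_on X},
    ip = (\<lambda>f g. \<Sum>\<^sub>\<infinity>x\<in>X. f x * cnj (g x))\<rparr>"

definition holomorphic_multi :: "(complex ^ 'd::finite \<Rightarrow> complex) \<Rightarrow> (complex ^ 'd) set \<Rightarrow> bool"
  where "holomorphic_multi f S \<longleftrightarrow>
    (\<forall>z\<in>S. \<exists>f'. (f has_derivative f') (at z) \<and> (\<forall>c h. f' (c *s h) = c * f' h))"

text \<open>\<open>H\<close> is the Hilbert space of \<open>E\<close>-valued holomorphic functions on the open unit ball
  with reproducing kernel \<open>K\<close>, where \<open>K z w\<close> is an operator on \<open>E\<close>. Functions on the ball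
  are represented by total functions vanishing off the ball. Holomorphy of an \<open>E\<close>-valued
  function is expressed weakly, which for Hilbert spaces \<open>E\<close> agrees with norm holomorphy.\<close>

definition holomorphic_rkhs ::
    "'e::complex_vector hilbert \<Rightarrow> (complex ^ 'd \<Rightarrow> complex ^ 'd \<Rightarrow> 'e \<Rightarrow> 'e)
      \<Rightarrow> (complex ^ 'd::finite \<Rightarrow> 'e) hilbert \<Rightarrow> bool"
  where "holomorphic_rkhs E K H \<longleftrightarrow>
    hilbert_space H \<and>
    (\<forall>f\<in>vecs H.
      (\<forall>z\<in>ball 0 1. f z \<in> vecs E) \<and>
      (\<forall>z. z \<notin> ball 0 1 \<longrightarrow> f z = 0) \<and>
      (\<forall>x\<in>vecs E. holomorphic_multi (\<lambda>z. ip E (f z) x) (ball 0 1))) \<and>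
    (\<forall>w\<in>ball 0 1. \<forall>x\<in>vecs E.
      (\<lambda>z. if z \<in> ball 0 1 then K z w x else 0) \<in> vecs H \<and>
      (\<forall>f\<in>vecs H. ip H f (\<lambda>z. if z \<in> ball 0 1 then K z w x else 0) = ip E (f w) x))"

definition mult_coord ::
    "'d \<Rightarrow> (complex ^ 'd::finite \<Rightarrow> 'e) \<Rightarrow> complex ^ 'd \<Rightarrow> 'e::complex_vector"
  where "mult_coord k f = (\<lambda>z. (z $ k) *\<^sub>C f z)"

definition coord_invariant :: "(complex ^ 'd::finite \<Rightarrow> 'e::complex_vector) hilbert \<Rightarrow> bool"
  where "coord_invariant H \<longleftrightarrow> (\<forall>k. \<forall>f\<in>vecs H. mult_coord k f \<in> vecs H)"

definition unitary_map :: "'a::complex_vector hilbert \<Rightarrow> 'b::complex_vector hilbert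
      \<Rightarrow> ('a \<Rightarrow> 'b) \<Rightarrow> bool"
  where "unitary_map H K U \<longleftrightarrow>
    bij_betw U (vecs H) (vecs K) \<and>
    (\<forall>f\<in>vecs H. \<forall>g\<in>vecs H. U (f + g) = U f + U g) \<and>
    (\<forall>c. \<forall>f\<in>vecs H. U (c *\<^sub>C f) = c *\<^sub>C U f) \<and>
    (\<forall>f\<in>vecs H. \<forall>g\<in>vecs H. ip K (U f) (U g) = ip H f g)"

text \<open>Being modules, both spaces must be invariant under multiplication by the coordinate
  functions; boundedness of these multiplications then follows from the closed graph theorem.\<close>

definition hilbert_module_iso ::
    "(complex ^ 'd::finite \<Rightarrow> 'e::complex_vector) hilbert
      \<Rightarrow> (complex ^ 'd \<Rightarrow> 'f::complex_vector) hilbert \<Rightarrow> bool"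
  where "hilbert_module_iso H K \<longleftrightarrow>
    coord_invariant H \<and> coord_invariant K \<and>
    (\<exists>U. unitary_map H K U \<and>
      (\<forall>k. \<forall>f\<in>vecs H. U (mult_coord k f) = mult_coord k (U f)))"

definition DA_kernel :: "nat \<Rightarrow> complex ^ 'd::finite \<Rightarrow> complex ^ 'd \<Rightarrow> complex \<Rightarrow> complex"
  where "DA_kernel a z w x = inverse ((1 - (\<Sum>j\<in>UNIV. z $ j * cnj (w $ j))) ^ a) * x"

definition is_DA_module :: "nat \<Rightarrow> (complex ^ 'd::finite \<Rightarrow> complex) hilbert \<Rightarrow> bool"
  where "is_DA_module a H \<longleftrightarrow> holomorphic_rkhs complex_hilbert (DA_kernel a) H"

record 'v dgraph =
  verts :: "'v set"
  edges :: "'v rel"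

definition no_parent :: "'v dgraph \<Rightarrow> 'v \<Rightarrow> bool"
  where "no_parent G v \<longleftrightarrow> (\<forall>u. (u, v) \<notin> edges G)"

definition rooted_directed_tree :: "'v dgraph \<Rightarrow> bool"
  where "rooted_directed_tree G \<longleftrightarrow>
    edges G \<subseteq> verts G \<times> verts G \<and>
    (\<forall>u\<in>verts G. \<forall>v\<in>verts G. (u, v) \<in> (edges G \<union> (edges G)\<inverse>)\<^sup>*) \<and>
    acyclic (edges G) \<and>
    (\<forall>u u' v. (u, v) \<in> edges G \<longrightarrow> (u', v) \<in> edges G \<longrightarrow> u = u') \<and>
    (\<exists>!r. r \<in> verts G \<and> no_parent G r)"

definition tree_root :: "'v dgraph \<Rightarrow> 'v"
  where "tree_root G = (THE r. r \<in> verts G \<and> no_parent G r)"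

definition Chi :: "'v dgraph \<Rightarrow> 'v \<Rightarrow> 'v set"
  where "Chi G u = {v. (u, v) \<in> edges G}"

definition par :: "'v dgraph \<Rightarrow> 'v \<Rightarrow> 'v"
  where "par G u = (THE p. (p, u) \<in> edges G)"

definition sib :: "'v dgraph \<Rightarrow> 'v \<Rightarrow> 'v set"
  where "sib G u = Chi G (par G u)"

definition depth :: "'v dgraph \<Rightarrow> 'v \<Rightarrow> nat"
  where "depth G u = (THE n. (tree_root G, u) \<in> edges G ^^ n)"

definition leafless :: "'v dgraph \<Rightarrow> bool"
  where "leafless G \<longleftrightarrow> (\<forall>u\<in>verts G. Chi G u \<noteq> {})"

definition locally_finite :: "'v dgraph \<Rightarrow> bool"
  where "locally_finite G \<longleftrightarrow> (\<forall>u\<in>verts G. finite (Chi G u))"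

definition branching_vertices :: "'v dgraph \<Rightarrow> 'v set"
  where "branching_vertices G =
    {u \<in> verts G. \<exists>v w. v \<noteq> w \<and> v \<in> Chi G u \<and> w \<in> Chi G u}"

definition dgraph_iso :: "'v dgraph \<Rightarrow> 'w dgraph \<Rightarrow> bool"
  where "dgraph_iso G H \<longleftrightarrow>
    (\<exists>\<phi>. bij_betw \<phi> (verts G) (verts H) \<and>
      (\<forall>u\<in>verts G. \<forall>v\<in>verts G. (u, v) \<in> edges G \<longleftrightarrow> (\<phi> u, \<phi> v) \<in> edges H))"

definition nat_tree :: "nat dgraph"
  where "nat_tree = \<lparr>verts = UNIV, edges = {(n, Suc n) | n. True}\<rparr>"

text \<open>The trees are indexed by a finite type \<open>'d\<close> in place of \<open>{1, \<dots>, d}\<close> and have their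
  vertices in one common type \<open>'v\<close>, which for countable trees is no restriction.\<close>

definition cart_prod :: "('d \<Rightarrow> 'v dgraph) \<Rightarrow> ('d \<Rightarrow> 'v) dgraph"
  where "cart_prod T =
    (let V = {v. \<forall>j. v j \<in> verts (T j)} in
     \<lparr>verts = V,
      edges = {(v, w). v \<in> V \<and> w \<in> V \<and>
        (\<exists>k. (\<forall>j. j \<noteq> k \<longrightarrow> v j = w j) \<and> (v k, w k) \<in> edges (T k))}\<rparr>)"

definition finite_joint_branching_index :: "('d \<Rightarrow> 'v dgraph) \<Rightarrow> bool"
  where "finite_joint_branching_index T \<longleftrightarrow>
    (\<forall>j. bdd_above (depth (T j) ` branching_vertices (T j)))"

definition mdepth :: "('d \<Rightarrow> 'v dgraph) \<Rightarrow> ('d \<Rightarrow> 'v) \<Rightarrow> 'd \<Rightarrow> nat"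
  where "mdepth T v = (\<lambda>j. depth (T j) (v j))"

definition Chi_at :: "('d \<Rightarrow> 'v dgraph) \<Rightarrow> 'd \<Rightarrow> ('d \<Rightarrow> 'v) \<Rightarrow> ('d \<Rightarrow> 'v) set"
  where "Chi_at T j v =
    {w \<in> verts (cart_prod T). (\<forall>i. i \<noteq> j \<longrightarrow> w i = v i) \<and> w j \<in> Chi (T j) (v j)}"

definition sib_at :: "('d \<Rightarrow> 'v dgraph) \<Rightarrow> 'd \<Rightarrow> ('d \<Rightarrow> 'v) \<Rightarrow> ('d \<Rightarrow> 'v) set"
  where "sib_at T j v =
    {w \<in> verts (cart_prod T). (\<forall>i. i \<noteq> j \<longrightarrow> w i = v i) \<and> w j \<in> sib (T j) (v j)}"

text \<open>\<open>weight T a j w\<close> is meaningful only if \<open>w j\<close> is not the root; then \<open>v\<close> below is the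
  unique vertex with \<open>w \<in> Chi_at T j v\<close>.\<close>

definition weight :: "('d::finite \<Rightarrow> 'v dgraph) \<Rightarrow> nat \<Rightarrow> 'd \<Rightarrow> ('d \<Rightarrow> 'v) \<Rightarrow> real"
  where "weight T a j w =
    (let v = w(j := par (T j) (w j)) in
      1 / sqrt (real (card (Chi_at T j v))) *
      sqrt (real (mdepth T v j + 1) / real ((\<Sum>i\<in>UNIV. mdepth T v i) + a)))"

definition shift_basis :: "('d::finite \<Rightarrow> 'v dgraph) \<Rightarrow> nat \<Rightarrow> 'd \<Rightarrow> ('d \<Rightarrow> 'v)
      \<Rightarrow> ('d \<Rightarrow> 'v) \<Rightarrow> complex"
  where "shift_basis T a j v = (\<Sum>w\<in>Chi_at T j v. of_real (weight T a j w) *\<^sub>C indicator {w})"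

text \<open>The bounded linear extension of \<open>e\<^sub>v \<mapsto> shift_basis T a j v\<close> to \<open>l2\<close>, written
  coordinatewise; at every \<open>w\<close> at most one summand is nonzero.\<close>

definition multishift :: "('d::finite \<Rightarrow> 'v dgraph) \<Rightarrow> nat \<Rightarrow> 'd
      \<Rightarrow> (('d \<Rightarrow> 'v) \<Rightarrow> complex) \<Rightarrow> ('d \<Rightarrow> 'v) \<Rightarrow> complex"
  where "multishift T a j f =
    (\<lambda>w. \<Sum>\<^sub>\<infinity>v\<in>verts (cart_prod T). f v * shift_basis T a j v w)"

definition joint_kernel :: "('d::finite \<Rightarrow> 'v dgraph) \<Rightarrow> nat \<Rightarrow> (('d \<Rightarrow> 'v) \<Rightarrow> complex) hilbert"
  where "joint_kernel T a =
    (let L = l2 (verts (cart_prod T)) in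
     \<lparr>vecs = {f \<in> vecs L. \<forall>j. hilbert_adjoint L (multishift T a j) f = 0}, ip = ip L\<rparr>)"

definition Phi :: "('d \<Rightarrow> 'v dgraph) \<Rightarrow> 'd set \<Rightarrow> ('d \<Rightarrow> 'v) set"
  where "Phi T F =
    {v \<in> verts (cart_prod T). \<forall>j. if j \<in> F then v j \<noteq> tree_root (T j) else v j = tree_root (T j)}"

definition sib_set :: "('d \<Rightarrow> 'v dgraph) \<Rightarrow> 'd set \<Rightarrow> ('d \<Rightarrow> 'v) \<Rightarrow> ('d \<Rightarrow> 'v) set"
  where "sib_set T F u =
    {w \<in> verts (cart_prod T). \<forall>j. if j \<in> F then w j \<in> sib (T j) (u j) else w j = u j}"

definition sib_transversal :: "('d \<Rightarrow> 'v dgraph) \<Rightarrow> ('d set \<Rightarrow> ('d \<Rightarrow> 'v) set) \<Rightarrow> bool"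
  where "sib_transversal T \<Omega> \<longleftrightarrow>
    (\<forall>F. \<Omega> F \<subseteq> Phi T F \<and> (\<forall>u\<in>Phi T F. \<exists>!w. w \<in> \<Omega> F \<and> w \<in> sib_set T F u))"

definition restr :: "('d \<Rightarrow> 'v dgraph) \<Rightarrow> 'd set \<Rightarrow> ('d \<Rightarrow> 'v) \<Rightarrow> 'd \<Rightarrow> 'v"
  where "restr T G v = (\<lambda>j. if j \<in> G then v j else tree_root (T j))"

definition L_space :: "('d::finite \<Rightarrow> 'v dgraph) \<Rightarrow> nat \<Rightarrow> 'd set \<Rightarrow> ('d \<Rightarrow> 'v)
      \<Rightarrow> (('d \<Rightarrow> 'v) \<Rightarrow> complex) set"
  where "L_space T a F u =
    {f \<in> vecs (l2 (sib_set T F u)).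
      \<forall>j\<in>F. \<forall>v\<in>restr T (F - {j}) ` sib_set T F u.
        (\<Sum>w\<in>sib_at T j (v(j := u j)). f w * of_real (weight T a j w)) = 0}"

definition mfact :: "('d::finite \<Rightarrow> nat) \<Rightarrow> real"
  where "mfact \<alpha> = (\<Prod>j\<in>UNIV. fact (\<alpha> j))"

definition mpow :: "complex ^ 'd::finite \<Rightarrow> ('d \<Rightarrow> nat) \<Rightarrow> complex"
  where "mpow z \<alpha> = (\<Prod>j\<in>UNIV. (z $ j) ^ \<alpha> j)"

definition scalar_kernel ::
    "nat \<Rightarrow> ('d \<Rightarrow> nat) \<Rightarrow> complex ^ 'd::finite \<Rightarrow> complex ^ 'd \<Rightarrow> complex"
  where "scalar_kernel a \<delta> z w =
    (\<Sum>\<^sub>\<infinity>\<alpha>\<in>UNIV.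
      of_real (mfact \<delta> / mfact (\<lambda>j. \<delta> j + \<alpha> j) *
        (\<Prod>i<(\<Sum>j\<in>UNIV. \<alpha> j). real ((\<Sum>j\<in>UNIV. \<delta> j) + a + i))) *
      mpow z \<alpha> * cnj (mpow w \<alpha>))"

text \<open>The sum over \<open>\<Omega> F\<close> is over a possibly infinite set, so it is taken pointwise as an
  infinite sum; for finite joint branching index only finitely many projections are nonzero.\<close>

definition tree_kernel ::
    "('d::finite \<Rightarrow> 'v dgraph) \<Rightarrow> ('d set \<Rightarrow> ('d \<Rightarrow> 'v) set) \<Rightarrow> nat
      \<Rightarrow> complex ^ 'd \<Rightarrow> complex ^ 'd \<Rightarrow> (('d \<Rightarrow> 'v) \<Rightarrow> complex) \<Rightarrow> ('d \<Rightarrow> 'v) \<Rightarrow> complex"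
  where "tree_kernel T \<Omega> a z w x =
    (\<lambda>v. \<Sum>F\<in>UNIV. \<Sum>\<^sub>\<infinity>u\<in>\<Omega> F.
      scalar_kernel a (mdepth T u) z w * orth_proj (joint_kernel T a) (L_space T a F u) x v)"

definition is_tree_DA_module ::
    "('d::finite \<Rightarrow> 'v dgraph) \<Rightarrow> ('d set \<Rightarrow> ('d \<Rightarrow> 'v) set) \<Rightarrow> nat
      \<Rightarrow> (complex ^ 'd \<Rightarrow> ('d \<Rightarrow> 'v) \<Rightarrow> complex) hilbert \<Rightarrow> bool"
  where "is_tree_DA_module T \<Omega> a H \<longleftrightarrow>
    holomorphic_rkhs (joint_kernel T a) (tree_kernel T \<Omega> a) H"

end

(* The module HT has the E-valued constants as joint kernel of the adjoints of the coordinate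
   multiplications, whereas for HA this joint kernel is the line of scalar constants. A branching
   vertex b of some factor gives, besides the indicator of the root, the vector e_c - e_c' of E for
   two children c, c' of b, so an isomorphism rules out branching. Conversely, without branching E is
   spanned by the indicator of the root and the two kernels coincide.

   The module HA is compared with l2 of the multi-indices through the expansion of its kernel:
   two families of vectors that are total in their Hilbert spaces and have the same Gram matrix
   correspond under a unitary, and under this unitary the coordinate multiplications become weighted
   shifts. This also yields the invariance of both modules under the coordinate multiplications. *)

theory Submission
  imports Defs
begin

section \<open>Hilbert spaces on carrier sets\<close>

text \<open>The tree module is given only by its reproducing property, and stability under
  multiplication by \<open>z_k\<close> is part of what an isomorphism asserts. It comes with the
  assumed isomorphism in one direction but has to be established in the other, where kernel
  functions are the only vectors that the defining property supplies. This is why everything passes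
  through inner products of kernel functions, and why density of a total span, hence the projection
  argument, is developed for spaces given by carrier sets.

  Pairing with a kernel function at 0 evaluates at 0, where every \<open>z_k f\<close> vanishes;
  this gives the orthogonality to the coordinate multiples. In the scalar module it leaves only a
  line because all coefficients \<open>(a)_|\<alpha>| / \<alpha>!\<close> of the kernel are
  positive, so that each nonconstant monomial is a coordinate times another monomial of nonzero
  weight.

  \<open>E\<close> enters through explicit vectors of a single \<open>L_space\<close>. These spaces
  have disjoint supports, so the tree kernel acts on each by a scalar, and at \<open>(0, 0)\<close>
  this scalar is 1 whatever the depth.\<close>

lemma scaleC_zero_left [simp]: "0 *\<^sub>C (x::'a::complex_vector) = 0"
  using scaleC_add_left[of 0 0 x] by simp

lemma scaleC_zero_right [simp]: "c *\<^sub>C (0::'a::complex_vector) = 0"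
  using scaleC_add_right[of c 0 "0::'a"] by simp

lemma scaleC_minus_one: "(-1) *\<^sub>C (x::'a::complex_vector) = - x"
proof -
  have "(-1) *\<^sub>C x + 1 *\<^sub>C x = 0"
    by (subst scaleC_add_left[symmetric]) simp
  then show ?thesis
    by (simp add: scaleC_one add_eq_0_iff2)
qed

lemma scaleC_fun_apply [simp]: "(c *\<^sub>C f) x = c *\<^sub>C f x"
  by (simp add: scaleC_fun_def)

lemma scaleC_complex_eq [simp]: "c *\<^sub>C (x::complex) = c * x"
  by (simp add: scaleC_complex_def)

locale hilbert_structure =
  fixes H :: "'a::complex_vector hilbert"
  assumes hilbert_space: "hilbert_space H"
begin

lemma zero_mem [simp]: "0 \<in> vecs H"
  using hilbert_space unfolding hilbert_space_def by (elim conjE)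

lemma add_mem [simp]: "f \<in> vecs H \<Longrightarrow> g \<in> vecs H \<Longrightarrow> f + g \<in> vecs H"
  using hilbert_space unfolding hilbert_space_def by (elim conjE) (drule bspec, assumption)+

lemma scale_mem [simp]: "f \<in> vecs H \<Longrightarrow> c *\<^sub>C f \<in> vecs H"
  using hilbert_space unfolding hilbert_space_def by (elim conjE) (meson)

lemma ip_add_left: "f \<in> vecs H \<Longrightarrow> g \<in> vecs H \<Longrightarrow> h \<in> vecs H \<Longrightarrow> ip H (f + g) h = ip H f h + ip H g h"
  using hilbert_space unfolding hilbert_space_def by (elim conjE) (meson)

lemma ip_scale_left: "f \<in> vecs H \<Longrightarrow> g \<in> vecs H \<Longrightarrow> ip H (c *\<^sub>C f) g = c * ip H f g"
  using hilbert_space unfolding hilbert_space_def by (elim conjE) (meson)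

lemma ip_commute: "f \<in> vecs H \<Longrightarrow> g \<in> vecs H \<Longrightarrow> ip H g f = cnj (ip H f g)"
  using hilbert_space unfolding hilbert_space_def by (elim conjE) (meson)

lemma ip_pos: "f \<in> vecs H \<Longrightarrow> f \<noteq> 0 \<Longrightarrow> 0 < Re (ip H f f)"
  using hilbert_space unfolding hilbert_space_def by (elim conjE) (meson)

lemma complete:
  assumes "\<And>n::nat. X n \<in> vecs H"
    and "\<And>e. e > 0 \<Longrightarrow> \<exists>N. \<forall>m\<ge>N. \<forall>n\<ge>N. hnorm H (X m - X n) < e"
  shows "\<exists>f\<in>vecs H. (\<lambda>n. hnorm H (X n - f)) \<longlonglongrightarrow> 0"
proof -
  have "(\<forall>n. X n \<in> vecs H) \<and> (\<forall>e>0. \<exists>N. \<forall>m\<ge>N. \<forall>n\<ge>N. hnorm H (X m - X n) < e)"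
    using assms by (intro conjI allI impI)
  moreover have "\<forall>X. (\<forall>n::nat. X n \<in> vecs H) \<and>
      (\<forall>e>0. \<exists>N. \<forall>m\<ge>N. \<forall>n\<ge>N. hnorm H (X m - X n) < e) \<longrightarrow>
      (\<exists>f\<in>vecs H. (\<lambda>n. hnorm H (X n - f)) \<longlonglongrightarrow> 0)"
    using hilbert_space unfolding hilbert_space_def by (elim conjE)
  ultimately show ?thesis
    by (elim allE[of _ X] impE)
qed

lemma diff_mem [simp]: "f \<in> vecs H \<Longrightarrow> g \<in> vecs H \<Longrightarrow> f - g \<in> vecs H"
  using add_mem[OF _ scale_mem[of g "-1"], of f] by (simp add: scaleC_minus_one)

lemma ip_add_right:
  "f \<in> vecs H \<Longrightarrow> g \<in> vecs H \<Longrightarrow> h \<in> vecs H \<Longrightarrow> ip H f (g + h) = ip H f g + ip H f h"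
  by (metis add_mem complex_cnj_add ip_add_left ip_commute)

lemma ip_scale_right: "f \<in> vecs H \<Longrightarrow> g \<in> vecs H \<Longrightarrow> ip H f (c *\<^sub>C g) = cnj c * ip H f g"
  by (metis complex_cnj_mult ip_commute ip_scale_left scale_mem)

lemma ip_diff_left:
  "f \<in> vecs H \<Longrightarrow> g \<in> vecs H \<Longrightarrow> h \<in> vecs H \<Longrightarrow> ip H (f - g) h = ip H f h - ip H g h"
  by (metis add_diff_cancel_right' diff_add_cancel diff_mem ip_add_left)

lemma ip_diff_right:
  "f \<in> vecs H \<Longrightarrow> g \<in> vecs H \<Longrightarrow> h \<in> vecs H \<Longrightarrow> ip H f (g - h) = ip H f g - ip H f h"
  by (metis add_diff_cancel_right' diff_add_cancel diff_mem ip_add_right)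

lemma ip_zero_left [simp]: "f \<in> vecs H \<Longrightarrow> ip H 0 f = 0"
  using ip_scale_left[of f f 0] by simp

lemma ip_zero_right [simp]: "f \<in> vecs H \<Longrightarrow> ip H f 0 = 0"
  using ip_scale_right[of f f 0] by simp

lemma ip_self_nonneg: "f \<in> vecs H \<Longrightarrow> 0 \<le> Re (ip H f f)"
  using ip_pos[of f] by (cases "f = 0") auto

lemma hnorm_nonneg [simp]: "0 \<le> hnorm H f" if "f \<in> vecs H"
  using ip_self_nonneg[OF that] by (simp add: hnorm_def)

lemma hnorm_square: "f \<in> vecs H \<Longrightarrow> (hnorm H f)\<^sup>2 = Re (ip H f f)"
  by (simp add: hnorm_def ip_self_nonneg)

lemma ip_self: "ip H f f = of_real ((hnorm H f)\<^sup>2)" if "f \<in> vecs H"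
proof -
  have "Im (ip H f f) = 0"
    using arg_cong[OF ip_commute[OF that that], of Im] by simp
  then show ?thesis
    by (simp add: hnorm_square that complex_eq_iff)
qed

lemma hnorm_eq_0 [simp]: "f \<in> vecs H \<Longrightarrow> hnorm H f = 0 \<longleftrightarrow> f = 0"
  using ip_pos[of f] by (cases "f = 0") (auto simp: hnorm_def)

lemma ip_self_eq_0 [simp]: "f \<in> vecs H \<Longrightarrow> ip H f f = 0 \<longleftrightarrow> f = 0"
  using ip_pos[of f] by (cases "f = 0") auto

section \<open>Near-minimal distance, Cauchy-Schwarz and density\<close>

lemma hnorm_diff_scale_square:
  assumes "f \<in> vecs H" "g \<in> vecs H"
  shows "(hnorm H (f - c *\<^sub>C g))\<^sup>2 =
    (hnorm H f)\<^sup>2 - 2 * Re (cnj c * ip H f g) + (cmod c)\<^sup>2 * (hnorm H g)\<^sup>2"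
proof -
  have "ip H (f - c *\<^sub>C g) (f - c *\<^sub>C g) =
      ip H f f - (cnj c * ip H f g + cnj (cnj c * ip H f g)) + c * cnj c * ip H g g"
    using assms
    by (simp add: ip_diff_left ip_diff_right ip_scale_left ip_scale_right
        ip_commute[of f g] algebra_simps)
  also have "\<dots> = of_real ((hnorm H f)\<^sup>2 - 2 * Re (cnj c * ip H f g) + (cmod c)\<^sup>2 * (hnorm H g)\<^sup>2)"
    using assms by (simp only: ip_self complex_add_cnj complex_mult_cnj cmod_power2) simp
  finally show ?thesis
    using assms by (simp add: hnorm_square)
qed

text \<open>The best \<open>c\<close> is the coefficient
  \<open>ip H f g / (hnorm H g)\<^sup>2\<close> of the projection onto the line of \<open>g\<close>.
  Taking \<open>\<delta> = 0\<close> yields Cauchy-Schwarz; with \<open>\<delta>\<close> the squared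
  distance to a subspace, approximate minimisers become approximately orthogonal to it.\<close>

lemma ip_bound_of_near_minimal:
  assumes "f \<in> vecs H" "g \<in> vecs H" and min: "\<And>c. \<delta> \<le> (hnorm H (f - c *\<^sub>C g))\<^sup>2"
  shows "(cmod (ip H f g))\<^sup>2 \<le> (hnorm H g)\<^sup>2 * ((hnorm H f)\<^sup>2 - \<delta>)"
proof (cases "g = 0")
  case True
  then show ?thesis
    using assms hnorm_eq_0[of 0] by (simp del: hnorm_eq_0)
next
  case False
  define N where "N = (hnorm H g)\<^sup>2"
  have N: "N > 0"
    using False assms(2) by (simp add: N_def)
  define c where "c = ip H f g / of_real N"
  have 1: "Re (cnj c * ip H f g) = (cmod (ip H f g))\<^sup>2 / N"
    unfolding c_def using cmod_power2[of "ip H f g"]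
    by (simp add: add_divide_distrib[symmetric] power2_eq_square)
  have 2: "(cmod c)\<^sup>2 * N = (cmod (ip H f g))\<^sup>2 / N"
    using N unfolding c_def by (simp add: norm_divide power_divide power2_eq_square)
  have "\<delta> \<le> (hnorm H f)\<^sup>2 - (cmod (ip H f g))\<^sup>2 / N"
    using min[of c] unfolding hnorm_diff_scale_square[OF assms(1,2)]
    using 1 2 by (simp add: N_def)
  then have "(cmod (ip H f g))\<^sup>2 / N \<le> (hnorm H f)\<^sup>2 - \<delta>"
    by simp
  then show ?thesis
    using N by (simp add: N_def[symmetric] field_simps)
qed

lemma Cauchy_Schwarz:
  assumes "f \<in> vecs H" "g \<in> vecs H"
  shows "cmod (ip H f g) \<le> hnorm H f * hnorm H g"
proof (rule power2_le_imp_le)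
  show "(cmod (ip H f g))\<^sup>2 \<le> (hnorm H f * hnorm H g)\<^sup>2"
    using ip_bound_of_near_minimal[OF assms, of 0] by (simp add: power_mult_distrib mult.commute)
qed (use assms in simp)

lemma ip_tendsto_left:
  assumes "\<And>n. X n \<in> vecs H" "f \<in> vecs H" "g \<in> vecs H"
    and "(\<lambda>n. hnorm H (X n - f)) \<longlonglongrightarrow> 0"
  shows "(\<lambda>n. ip H (X n) g) \<longlonglongrightarrow> ip H f g"
proof -
  have "(\<lambda>n. hnorm H (X n - f) * hnorm H g) \<longlonglongrightarrow> 0"
    using tendsto_mult_right[OF assms(4), of "hnorm H g"] by simp
  then have "(\<lambda>n. ip H (X n) g - ip H f g) \<longlonglongrightarrow> 0"
  proof (rule Lim_null_comparison[rotated])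
    show "\<forall>\<^sub>F n in sequentially. cmod (ip H (X n) g - ip H f g) \<le> hnorm H (X n - f) * hnorm H g"
      using Cauchy_Schwarz[of "X _ - f" g] assms(1-3) by (simp add: ip_diff_left)
  qed
  then show ?thesis
    by (rule LIM_zero_cancel)
qed

lemma ip_tendsto_right:
  assumes "\<And>n. X n \<in> vecs H" "f \<in> vecs H" "g \<in> vecs H"
    and "(\<lambda>n. hnorm H (X n - f)) \<longlonglongrightarrow> 0"
  shows "(\<lambda>n. ip H g (X n)) \<longlonglongrightarrow> ip H g f"
  using tendsto_cnj[OF ip_tendsto_left[OF assms]] assms(1-3) by (simp add: ip_commute[of _ g])

lemma hnorm_triangle:
  assumes "f \<in> vecs H" "g \<in> vecs H"
  shows "hnorm H (f - g) \<le> hnorm H f + hnorm H g"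
proof (rule power2_le_imp_le)
  have "(hnorm H (f - g))\<^sup>2 = (hnorm H f)\<^sup>2 - 2 * Re (ip H f g) + (hnorm H g)\<^sup>2"
    using hnorm_diff_scale_square[OF assms, of 1] by (simp add: scaleC_one)
  moreover have "- Re (ip H f g) \<le> hnorm H f * hnorm H g"
    using Cauchy_Schwarz[OF assms] abs_Re_le_cmod[of "ip H f g"] by linarith
  ultimately show "(hnorm H (f - g))\<^sup>2 \<le> (hnorm H f + hnorm H g)\<^sup>2"
    by (simp add: power2_sum)
qed (use assms in simp)

lemma convergent_Cauchy:
  assumes "\<And>n. X n \<in> vecs H" "f \<in> vecs H" "(\<lambda>n. hnorm H (X n - f)) \<longlonglongrightarrow> 0" "e > 0"
  shows "\<exists>N. \<forall>m\<ge>N. \<forall>n\<ge>N. hnorm H (X m - X n) < e"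
proof -
  obtain N where N: "\<And>n. n \<ge> N \<Longrightarrow> hnorm H (X n - f) < e / 2"
    using order_tendstoD(2)[OF assms(3), of "e / 2"] \<open>e > 0\<close> by (auto simp: eventually_sequentially)
  have "hnorm H (X m - X n) < e" if "m \<ge> N" "n \<ge> N" for m n
    using hnorm_triangle[of "X m - f" "X n - f"] N[OF that(1)] N[OF that(2)] assms(1,2) by simp
  then show ?thesis by blast
qed

text \<open>This is the parallelogram law for \<open>f - g\<close> and \<open>f - h\<close>, solved
  for their difference. The last term contains the midpoint of \<open>g\<close> and
  \<open>h\<close>, which lies in every subspace containing both, so the distance of
  \<open>f\<close> to the subspace bounds it from below.\<close>

lemma parallelogram:
  assumes "f \<in> vecs H" "g \<in> vecs H" "h \<in> vecs H"
  shows "(hnorm H (g - h))\<^sup>2 = 2 * (hnorm H (f - g))\<^sup>2 + 2 * (hnorm H (f - h))\<^sup>2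
    - 4 * (hnorm H (f - (1/2) *\<^sub>C (g + h)))\<^sup>2"
proof -
  have "Re (ip H h g) = Re (ip H g h)" "Re (ip H g f) = Re (ip H f g)" "Re (ip H h f) = Re (ip H f h)"
    using assms by (simp_all add: ip_commute[of g h] ip_commute[of f g] ip_commute[of f h])
  then show ?thesis
    using assms by (simp add: hnorm_square ip_diff_left ip_diff_right ip_scale_left ip_scale_right
        ip_add_left ip_add_right algebra_simps)
qed

text \<open>A sequence in \<open>D\<close> that minimises the distance to \<open>f\<close> is Cauchy by the parallelogram law, and
  its limit differs from \<open>f\<close> by a vector orthogonal to \<open>D\<close>.\<close>

lemma total_subspace_dense:
  assumes D: "D \<subseteq> vecs H" "0 \<in> D" "\<And>f g. f \<in> D \<Longrightarrow> g \<in> D \<Longrightarrow> f + g \<in> D"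
      "\<And>c f. f \<in> D \<Longrightarrow> c *\<^sub>C f \<in> D"
    and total: "\<And>f. f \<in> vecs H \<Longrightarrow> (\<And>g. g \<in> D \<Longrightarrow> ip H f g = 0) \<Longrightarrow> f = 0"
    and f: "f \<in> vecs H"
  obtains X where "\<And>n::nat. X n \<in> D" "(\<lambda>n. hnorm H (X n - f)) \<longlonglongrightarrow> 0"
proof -
  define A where "A = (\<lambda>g. (hnorm H (f - g))\<^sup>2) ` D"
  define \<delta> where "\<delta> = Inf A"
  have bdd: "bdd_below A"
    unfolding A_def by (auto intro!: bdd_belowI[of _ 0])
  have min: "\<delta> \<le> (hnorm H (f - g))\<^sup>2" if "g \<in> D" for g
    unfolding \<delta>_def using bdd that by (intro cInf_lower) (auto simp: A_def)
  have "\<exists>g\<in>D. (hnorm H (f - g))\<^sup>2 < \<delta> + 1 / real (Suc n)" for n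
  proof -
    have "Inf A < \<delta> + 1 / real (Suc n)"
      by (simp add: \<delta>_def)
    then show ?thesis
      using cInf_less_iff[OF _ bdd] D(2) by (auto simp: A_def)
  qed
  then obtain X where XD: "\<And>n. X n \<in> D" and X: "\<And>n. (hnorm H (f - X n))\<^sup>2 < \<delta> + 1 / real (Suc n)"
    by metis
  have XH [simp]: "X n \<in> vecs H" for n
    using XD D(1) by blast
  have dist: "(hnorm H (X m - X n))\<^sup>2 \<le> 2 / real (Suc m) + 2 / real (Suc n)" for m n
    using parallelogram[OF f XH[of m] XH[of n]] min[OF D(4)[OF D(3)[OF XD[of m] XD[of n]], of "1/2"]]
      X[of m] X[of n] by linarith
  have Cauchy: "\<exists>N. \<forall>m\<ge>N. \<forall>n\<ge>N. hnorm H (X m - X n) < e" if "e > 0" for e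
  proof -
    obtain N :: nat where "4 / e\<^sup>2 < real N"
      using reals_Archimedean2 by blast
    then have "4 < real N * e\<^sup>2"
      using that by (simp add: pos_divide_less_eq)
    also have "\<dots> \<le> real (Suc N) * e\<^sup>2"
      by (intro mult_right_mono) auto
    finally have N: "4 / real (Suc N) < e\<^sup>2"
      by (simp add: pos_divide_less_eq mult.commute)
    have "hnorm H (X m - X n) < e" if "m \<ge> N" "n \<ge> N" for m n
    proof (rule power2_less_imp_less)
      have "2 / real (Suc m) \<le> 2 / real (Suc N)" "2 / real (Suc n) \<le> 2 / real (Suc N)"
        using that by (auto intro!: divide_left_mono)
      with dist[of m n] N show "(hnorm H (X m - X n))\<^sup>2 < e\<^sup>2"
        by linarith
    qed (use \<open>e > 0\<close> in simp)
    then show ?thesis by blast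
  qed
  obtain p where p: "p \<in> vecs H" and lim: "(\<lambda>n. hnorm H (X n - p)) \<longlonglongrightarrow> 0"
    using complete[OF XH Cauchy] by blast
  have "ip H (f - p) g = 0" if g: "g \<in> D" for g
  proof -
    have gH: "g \<in> vecs H"
      using g D(1) by blast
    \<comment> \<open>\<open>X n + c *\<^sub>C g\<close> stays in \<open>D\<close>, hence at squared
      distance at least \<open>\<delta>\<close> from \<open>f\<close>, while \<open>X n\<close>
      exceeds this by less than \<open>1 / real (Suc n)\<close>.\<close>
    have bound: "(cmod (ip H (f - X n) g))\<^sup>2 \<le> (hnorm H g)\<^sup>2 * (1 / real (Suc n))" for n
    proof -
      have "\<delta> \<le> (hnorm H (f - X n - c *\<^sub>C g))\<^sup>2" for c
        using min[OF D(3)[OF XD[of n] D(4)[OF g, of c]]] by (simp add: algebra_simps)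
      then have "(cmod (ip H (f - X n) g))\<^sup>2 \<le> (hnorm H g)\<^sup>2 * ((hnorm H (f - X n))\<^sup>2 - \<delta>)"
        using f gH by (intro ip_bound_of_near_minimal) auto
      also have "\<dots> \<le> (hnorm H g)\<^sup>2 * (1 / real (Suc n))"
        using X[of n] by (intro mult_left_mono) auto
      finally show ?thesis .
    qed
    have "(\<lambda>n. (hnorm H g)\<^sup>2 * (1 / real (Suc n))) \<longlonglongrightarrow> 0"
      using tendsto_mult_right_zero[OF LIMSEQ_inverse_real_of_nat, of "(hnorm H g)\<^sup>2"]
      by (simp add: divide_inverse)
    then have "(\<lambda>n. (cmod (ip H (f - X n) g))\<^sup>2) \<longlonglongrightarrow> 0"
      by (rule Lim_null_comparison[rotated]) (use bound in auto)
    then have "(\<lambda>n. cmod (ip H (f - X n) g)) \<longlonglongrightarrow> 0"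
      using tendsto_real_sqrt[of "\<lambda>n. (cmod (ip H (f - X n) g))\<^sup>2" 0] by simp
    then have "(\<lambda>n. ip H (f - X n) g) \<longlonglongrightarrow> 0"
      by (rule tendsto_norm_zero_cancel)
    moreover have "(\<lambda>n. ip H (f - X n) g) \<longlonglongrightarrow> ip H (f - p) g"
      using tendsto_diff[OF tendsto_const ip_tendsto_left[OF XH p gH lim], of "ip H f g"] f gH p
      by (simp add: ip_diff_left)
    ultimately show ?thesis
      using LIMSEQ_unique by blast
  qed
  then have "f - p = 0"
    using f p by (intro total) auto
  then show ?thesis
    using that[of X] XD lim by simp
qed

end

section \<open>Square-summable functions\<close>

lemma l2_mem_iff:
  "f \<in> vecs (l2 X) \<longleftrightarrow> (\<forall>x. x \<notin> X \<longrightarrow> f x = 0) \<and> (\<lambda>x. (cmod (f x))\<^sup>2) summable_on X"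
  by (simp add: l2_def)

lemma ip_l2: "ip (l2 X) f g = (\<Sum>\<^sub>\<infinity>x\<in>X. f x * cnj (g x))"
  by (simp add: l2_def)

lemma l2_abs_summable:
  assumes "f \<in> vecs (l2 X)" "g \<in> vecs (l2 X)"
  shows "(\<lambda>x. cmod (f x * cnj (g x))) summable_on X"
proof (rule Infinite_Sum.abs_summable_on_comparison_test')
  show "(\<lambda>x. (cmod (f x))\<^sup>2 + (cmod (g x))\<^sup>2) summable_on X"
    using assms by (auto simp: l2_mem_iff intro: summable_on_add)
  show "cmod (f x * cnj (g x)) \<le> (cmod (f x))\<^sup>2 + (cmod (g x))\<^sup>2" for x
    using sum_squares_bound[of "cmod (f x)" "cmod (g x)"]
      mult_nonneg_nonneg[OF norm_ge_zero norm_ge_zero, of "f x" "g x"]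
    unfolding norm_mult complex_mod_cnj by linarith
qed

lemma l2_summable:
  assumes "f \<in> vecs (l2 X)" "g \<in> vecs (l2 X)"
  shows "(\<lambda>x. f x * cnj (g x)) summable_on X"
  using l2_abs_summable[OF assms] by (rule abs_summable_summable)

lemma l2_ip_self:
  assumes "f \<in> vecs (l2 X)"
  shows "ip (l2 X) f f = of_real (\<Sum>\<^sub>\<infinity>x\<in>X. (cmod (f x))\<^sup>2)"
proof -
  have "(\<Sum>\<^sub>\<infinity>x\<in>X. of_real ((cmod (f x))\<^sup>2) :: complex) = of_real (\<Sum>\<^sub>\<infinity>x\<in>X. (cmod (f x))\<^sup>2)"
    using assms by (intro infsumI has_sum_of_real has_sum_infsum) (simp add: l2_mem_iff)
  then show ?thesis
    unfolding ip_l2 by (simp add: complex_norm_square del: of_real_power)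
qed

lemma l2_hnorm_square:
  assumes "f \<in> vecs (l2 X)"
  shows "(hnorm (l2 X) f)\<^sup>2 = (\<Sum>\<^sub>\<infinity>x\<in>X. (cmod (f x))\<^sup>2)"
  using assms by (simp add: hnorm_def l2_ip_self infsum_nonneg)

lemma l2_hnorm_nonneg: "f \<in> vecs (l2 X) \<Longrightarrow> 0 \<le> hnorm (l2 X) f"
  by (simp add: hnorm_def l2_ip_self infsum_nonneg)

lemma l2_finite_sum_le:
  assumes "f \<in> vecs (l2 X)" "finite S" "S \<subseteq> X"
  shows "(\<Sum>x\<in>S. (cmod (f x))\<^sup>2) \<le> (hnorm (l2 X) f)\<^sup>2"
  unfolding l2_hnorm_square[OF assms(1)]
  using assms by (intro finite_sum_le_infsum) (auto simp: l2_mem_iff)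

text \<open>Phrased with finite subsets because a bound on finite sums survives pointwise limits;
  \<open>l2_complete\<close> controls its limit function in this way.\<close>

lemma l2_bound:
  assumes "\<And>x. x \<notin> X \<Longrightarrow> f x = 0"
    and "\<And>S. finite S \<Longrightarrow> S \<subseteq> X \<Longrightarrow> (\<Sum>x\<in>S. (cmod (f x))\<^sup>2) \<le> C\<^sup>2"
    and "C \<ge> 0"
  shows "f \<in> vecs (l2 X)" "hnorm (l2 X) f \<le> C"
proof -
  have "(\<lambda>x. (cmod (f x))\<^sup>2) summable_on X"
    by (rule nonneg_bdd_above_summable_on) (use assms(2) in \<open>auto intro!: bdd_aboveI[of _ "C\<^sup>2"]\<close>)
  then show mem: "f \<in> vecs (l2 X)"
    using assms(1) by (simp add: l2_mem_iff)
  have "(hnorm (l2 X) f)\<^sup>2 \<le> C\<^sup>2"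
    unfolding l2_hnorm_square[OF mem]
    using mem assms(2) by (intro infsum_le_finite_sums) (auto simp: l2_mem_iff)
  then show "hnorm (l2 X) f \<le> C"
    using assms(3) power2_le_imp_le by blast
qed

lemma l2_add_mem:
  assumes "f \<in> vecs (l2 X)" "g \<in> vecs (l2 X)"
  shows "f + g \<in> vecs (l2 X)"
proof -
  have le: "(cmod ((f + g) x))\<^sup>2 \<le> 2 * (cmod (f x))\<^sup>2 + 2 * (cmod (g x))\<^sup>2" for x
  proof -
    have "(cmod (f x + g x))\<^sup>2 \<le> (cmod (f x) + cmod (g x))\<^sup>2"
      by (intro power_mono norm_triangle_ineq) auto
    also have "\<dots> \<le> 2 * (cmod (f x))\<^sup>2 + 2 * (cmod (g x))\<^sup>2"
      using sum_squares_bound[of "cmod (f x)" "cmod (g x)"] by (simp add: power2_sum)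
    finally show ?thesis by simp
  qed
  have "(\<lambda>x. 2 * (cmod (f x))\<^sup>2 + 2 * (cmod (g x))\<^sup>2) summable_on X"
    using assms by (auto simp: l2_mem_iff intro!: summable_on_add summable_on_cmult_right)
  then have "(\<lambda>x. (cmod ((f + g) x))\<^sup>2) summable_on X"
    by (rule summable_on_comparison_test) (rule le, simp)
  then show ?thesis
    using assms by (simp add: l2_mem_iff)
qed

lemma l2_scale_mem:
  assumes "f \<in> vecs (l2 X)"
  shows "c *\<^sub>C f \<in> vecs (l2 X)"
  using assms summable_on_cmult_right[of "\<lambda>x. (cmod (f x))\<^sup>2" X "(cmod c)\<^sup>2"]
  by (auto simp: l2_mem_iff norm_mult power_mult_distrib)

text \<open>Coordinates are dominated by the norm, so a Cauchy sequence converges pointwise. Letting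
  one of the two indices tend to infinity in the Cauchy estimate turns this into convergence in
  norm.\<close>

lemma l2_complete:
  assumes mem: "\<And>n::nat. F n \<in> vecs (l2 X)"
    and Cauchy: "\<And>e. e > 0 \<Longrightarrow> \<exists>N. \<forall>m\<ge>N. \<forall>n\<ge>N. hnorm (l2 X) (F m - F n) < e"
  shows "\<exists>f\<in>vecs (l2 X). (\<lambda>n. hnorm (l2 X) (F n - f)) \<longlonglongrightarrow> 0"
proof -
  have diff: "f - g \<in> vecs (l2 X)" if "f \<in> vecs (l2 X)" "g \<in> vecs (l2 X)" for f g
    using l2_add_mem[OF that(1) l2_scale_mem[OF that(2), of "-1"]] by (simp add: scaleC_minus_one)
  have pointwise: "cmod (f x) \<le> hnorm (l2 X) f" if "f \<in> vecs (l2 X)" for f x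
  proof (cases "x \<in> X")
    case True
    then show ?thesis
      using l2_finite_sum_le[OF that, of "{x}"] l2_hnorm_nonneg[OF that] power2_le_imp_le by auto
  next
    case False
    then show ?thesis
      using that l2_hnorm_nonneg[OF that] by (simp add: l2_mem_iff)
  qed
  have conv: "convergent (\<lambda>n. F n x)" for x
  proof (rule Cauchy_convergent, rule metric_CauchyI)
    fix e :: real assume "e > 0"
    then obtain N where N: "\<forall>m\<ge>N. \<forall>n\<ge>N. hnorm (l2 X) (F m - F n) < e"
      using Cauchy[OF \<open>e > 0\<close>] by blast
    have "dist (F m x) (F n x) < e" if "m \<ge> N" "n \<ge> N" for m n
      using pointwise[OF diff[OF mem[of m] mem[of n]], of x] N[rule_format, OF that]
      by (simp add: dist_norm)
    then show "\<exists>N. \<forall>m\<ge>N. \<forall>n\<ge>N. dist (F m x) (F n x) < e" by blast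
  qed
  define f where "f = (\<lambda>x. lim (\<lambda>n. F n x))"
  have f: "(\<lambda>n. F n x) \<longlonglongrightarrow> f x" for x
    using conv[of x] by (simp add: f_def convergent_LIMSEQ_iff)
  have f0: "f x = 0" if "x \<notin> X" for x
    using f[of x] mem that by (simp add: l2_mem_iff LIMSEQ_const_iff)
  have close: "F n - f \<in> vecs (l2 X) \<and> hnorm (l2 X) (F n - f) \<le> e"
    if e: "e > 0" and N: "\<forall>m\<ge>N. \<forall>n\<ge>N. hnorm (l2 X) (F m - F n) < e" and n: "n \<ge> N" for e N n
  proof -
    have "(\<Sum>x\<in>S. (cmod ((F n - f) x))\<^sup>2) \<le> e\<^sup>2" if S: "finite S" "S \<subseteq> X" for S
    proof (rule LIMSEQ_le_const2)
      show "(\<lambda>m. \<Sum>x\<in>S. (cmod ((F n - F m) x))\<^sup>2) \<longlonglongrightarrow> (\<Sum>x\<in>S. (cmod ((F n - f) x))\<^sup>2)"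
        by (auto intro!: tendsto_intros f)
      have "(\<Sum>x\<in>S. (cmod ((F n - F m) x))\<^sup>2) \<le> e\<^sup>2" if "m \<ge> N" for m
      proof -
        have "(\<Sum>x\<in>S. (cmod ((F n - F m) x))\<^sup>2) \<le> (hnorm (l2 X) (F n - F m))\<^sup>2"
          using S by (intro l2_finite_sum_le diff mem)
        also have "\<dots> \<le> e\<^sup>2"
          using N n that l2_hnorm_nonneg[OF diff[OF mem[of n] mem[of m]]]
          by (intro power_mono) (auto intro: less_imp_le)
        finally show ?thesis .
      qed
      then show "\<exists>N. \<forall>m\<ge>N. (\<Sum>x\<in>S. (cmod ((F n - F m) x))\<^sup>2) \<le> e\<^sup>2" by blast
    qed
    moreover have "(F n - f) x = 0" if "x \<notin> X" for x
      using f0[OF that] mem[of n] that by (simp add: l2_mem_iff)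
    ultimately show ?thesis
      using l2_bound[of X "F n - f" e] e by simp
  qed
  obtain N where "\<forall>m\<ge>N. \<forall>n\<ge>N. hnorm (l2 X) (F m - F n) < 1"
    using Cauchy[OF zero_less_one] by blast
  then have "F N - f \<in> vecs (l2 X)"
    using close[of 1 N N] by simp
  then have fmem: "f \<in> vecs (l2 X)"
    using diff[OF mem[of N]] by fastforce
  moreover have "(\<lambda>n. hnorm (l2 X) (F n - f)) \<longlonglongrightarrow> 0"
  proof (rule LIMSEQ_I)
    fix e :: real assume "e > 0"
    then obtain N where "\<forall>m\<ge>N. \<forall>n\<ge>N. hnorm (l2 X) (F m - F n) < e / 2"
      using Cauchy[of "e / 2", OF half_gt_zero] by blast
    then have "hnorm (l2 X) (F n - f) \<le> e / 2" if "n \<ge> N" for n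
      using close[of "e / 2" N n] \<open>e > 0\<close> that by simp
    then have "norm (hnorm (l2 X) (F n - f) - 0) < e" if "n \<ge> N" for n
      using that \<open>e > 0\<close> l2_hnorm_nonneg[OF diff[OF mem[of n] fmem]] by fastforce
    then show "\<exists>N. \<forall>n\<ge>N. norm (hnorm (l2 X) (F n - f) - 0) < e" by blast
  qed
  ultimately show ?thesis by blast
qed

lemma l2_hilbert_space: "hilbert_space (l2 X)"
  unfolding hilbert_space_def
proof (intro conjI allI ballI impI)
  show "0 \<in> vecs (l2 X)"
    by (simp add: l2_mem_iff)
next
  fix f g h assume m: "f \<in> vecs (l2 X)" "g \<in> vecs (l2 X)" "h \<in> vecs (l2 X)"
  show "ip (l2 X) (f + g) h = ip (l2 X) f h + ip (l2 X) g h"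
    using l2_summable[OF m(1,3)] l2_summable[OF m(2,3)]
    by (simp add: ip_l2 distrib_right infsum_add)
next
  fix f g assume m: "f \<in> vecs (l2 X)" "g \<in> vecs (l2 X)"
  show "ip (l2 X) g f = cnj (ip (l2 X) f g)"
    unfolding ip_l2 by (simp flip: infsum_cnj add: mult.commute)
  fix c show "ip (l2 X) (c *\<^sub>C f) g = c * ip (l2 X) f g"
    using l2_summable[OF m] by (simp add: ip_l2 mult.assoc infsum_cmult_right)
next
  fix f assume f: "f \<in> vecs (l2 X)" "f \<noteq> 0"
  then obtain x where x: "f x \<noteq> 0" "x \<in> X"
    by (auto simp: fun_eq_iff l2_mem_iff)
  then have "0 < (hnorm (l2 X) f)\<^sup>2"
    using l2_finite_sum_le[OF f(1), of "{x}"] by (auto intro: less_le_trans[rotated])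
  then show "0 < Re (ip (l2 X) f f)"
    using f by (simp add: l2_ip_self l2_hnorm_square)
next
  fix F :: "nat \<Rightarrow> 'a \<Rightarrow> complex"
  assume "(\<forall>n. F n \<in> vecs (l2 X)) \<and>
      (\<forall>e>0. \<exists>N. \<forall>m\<ge>N. \<forall>n\<ge>N. hnorm (l2 X) (F m - F n) < e)"
  then show "\<exists>f\<in>vecs (l2 X). (\<lambda>n. hnorm (l2 X) (F n - f)) \<longlonglongrightarrow> 0"
    by (elim conjE, intro l2_complete) auto
qed (auto intro: l2_add_mem l2_scale_mem)

interpretation l2: hilbert_structure "l2 X" for X
  by unfold_locales (rule l2_hilbert_space)

section \<open>Unitaries from equal Gram matrices\<close>

locale equal_gram =
  M: hilbert_structure M + H: hilbert_structure H
  for M :: "'a::complex_vector hilbert" and H :: "'b::complex_vector hilbert" +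
  fixes I :: "'i set" and m :: "'i \<Rightarrow> 'a" and k :: "'i \<Rightarrow> 'b"
  assumes m_mem: "i \<in> I \<Longrightarrow> m i \<in> vecs M"
    and k_mem: "i \<in> I \<Longrightarrow> k i \<in> vecs H"
    and gram: "i \<in> I \<Longrightarrow> j \<in> I \<Longrightarrow> ip M (m i) (m j) = ip H (k i) (k j)"
    and total_m: "f \<in> vecs M \<Longrightarrow> \<forall>i\<in>I. ip M f (m i) = 0 \<Longrightarrow> f = 0"
    and total_k: "g \<in> vecs H \<Longrightarrow> \<forall>i\<in>I. ip H g (k i) = 0 \<Longrightarrow> g = 0"
begin

text \<open>A relation rather than a map: a vector may have several expansions in the
  \<open>m i\<close>, and that they all lead to the same combination of the \<open>k i\<close> is a
  consequence of the equal Gram matrices.\<close>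

inductive span_pair :: "'a \<Rightarrow> 'b \<Rightarrow> bool" where
  span_pair_zero: "span_pair 0 0"
| span_pair_step: "span_pair f g \<Longrightarrow> i \<in> I \<Longrightarrow> span_pair (f + c *\<^sub>C m i) (g + c *\<^sub>C k i)"

text \<open>The graph of the future unitary, described by inner products with the two families
  instead of limits. Uniqueness of the partner is then totality of \<open>k\<close>, and linearity
  is immediate.\<close>

definition matches :: "'a \<Rightarrow> 'b \<Rightarrow> bool" where
  "matches f g \<longleftrightarrow> f \<in> vecs M \<and> g \<in> vecs H \<and> (\<forall>i\<in>I. ip M f (m i) = ip H g (k i))"

lemma span_pair_matches: "span_pair f g \<Longrightarrow> matches f g"
proof (induction rule: span_pair.induct)
  case span_pair_zero
  then show ?case
    by (simp add: matches_def m_mem k_mem)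
next
  case (span_pair_step f g i c)
  then show ?case
    by (simp add: matches_def m_mem k_mem M.ip_add_left H.ip_add_left M.ip_scale_left H.ip_scale_left gram)
qed

lemma matches_ip_span: "span_pair f' g' \<Longrightarrow> matches f g \<Longrightarrow> ip M f f' = ip H g g'"
proof (induction rule: span_pair.induct)
  case span_pair_zero
  then show ?case
    by (simp add: matches_def)
next
  case (span_pair_step f' g' i c)
  moreover have "f' \<in> vecs M" "g' \<in> vecs H"
    using span_pair_matches[OF span_pair_step.hyps(1)] by (auto simp: matches_def)
  ultimately show ?case
    by (simp add: matches_def m_mem k_mem M.ip_add_right H.ip_add_right M.ip_scale_right H.ip_scale_right)
qed

lemma span_pair_add: "span_pair f' g' \<Longrightarrow> span_pair f g \<Longrightarrow> span_pair (f + f') (g + g')"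
proof (induction rule: span_pair.induct)
  case (span_pair_step f' g' i c)
  then show ?case
    using span_pair.span_pair_step[of "f + f'" "g + g'" i c] by (simp add: add.assoc)
qed simp

lemma span_pair_scale: "span_pair f g \<Longrightarrow> span_pair (c *\<^sub>C f) (c *\<^sub>C g)"
proof (induction rule: span_pair.induct)
  case (span_pair_step f g i d)
  then show ?case
    using span_pair.span_pair_step[of "c *\<^sub>C f" "c *\<^sub>C g" i "c * d"]
    by (simp add: scaleC_add_right scaleC_scaleC)
qed (simp add: span_pair_zero)

lemma span_pair_hnorm_diff:
  assumes "span_pair f g" "span_pair f' g'"
  shows "hnorm M (f - f') = hnorm H (g - g')"
proof -
  have *: "span_pair (f - f') (g - g')"
    using span_pair_add[OF span_pair_scale[OF assms(2), of "-1"] assms(1)]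
    by (simp add: scaleC_minus_one)
  show ?thesis
    unfolding hnorm_def matches_ip_span[OF * span_pair_matches[OF *]] ..
qed

lemma matches_unique:
  assumes "matches f g" "matches f g'"
  shows "g = g'"
proof -
  have "g - g' = 0"
    using assms by (intro total_k) (auto simp: matches_def H.ip_diff_left k_mem)
  then show ?thesis by simp
qed

text \<open>Equal Gram matrices make the passage between the spans isometric, so combinations of the
  \<open>m i\<close> tending to \<open>f\<close> have a Cauchy, hence convergent, counterpart. The
  sequences are returned too, for use in \<open>matches_ip\<close>.\<close>

lemma matches_approx:
  assumes f: "f \<in> vecs M"
  obtains g X Y where "matches f g" "\<And>n::nat. span_pair (X n) (Y n)"
    "(\<lambda>n. hnorm M (X n - f)) \<longlonglongrightarrow> 0" "(\<lambda>n. hnorm H (Y n - g)) \<longlonglongrightarrow> 0"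
proof -
  define D where "D = {f. \<exists>g. span_pair f g}"
  have gen: "m i \<in> D" if "i \<in> I" for i
    using span_pair_step[OF span_pair_zero that, of 1] by (auto simp: D_def scaleC_one)
  obtain X where XD: "\<And>n::nat. X n \<in> D" and Xf: "(\<lambda>n. hnorm M (X n - f)) \<longlonglongrightarrow> 0"
  proof (rule M.total_subspace_dense[of D f])
    show "D \<subseteq> vecs M"
      using span_pair_matches by (auto simp: D_def matches_def)
    show "0 \<in> D"
      using span_pair_zero by (auto simp: D_def)
    show "f + g \<in> D" if "f \<in> D" "g \<in> D" for f g
      using that span_pair_add unfolding D_def by blast
    show "c *\<^sub>C f \<in> D" if "f \<in> D" for c f
      using that span_pair_scale unfolding D_def by blast
    show "h = 0" if "h \<in> vecs M" "\<And>g. g \<in> D \<Longrightarrow> ip M h g = 0" for h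
      using that(1) by (rule total_m) (simp add: that(2) gen)
    show "f \<in> vecs M"
      by (rule f)
    fix X assume "\<And>n. X n \<in> D" "(\<lambda>n. hnorm M (X n - f)) \<longlonglongrightarrow> 0"
    then show thesis by (rule that)
  qed
  obtain Y where XY: "\<And>n. span_pair (X n) (Y n)"
    using XD unfolding D_def mem_Collect_eq by metis
  have X: "X n \<in> vecs M" and Y: "Y n \<in> vecs H" for n
    using span_pair_matches[OF XY] by (auto simp: matches_def)
  obtain g where g: "g \<in> vecs H" and Yg: "(\<lambda>n. hnorm H (Y n - g)) \<longlonglongrightarrow> 0"
    using H.complete[OF Y M.convergent_Cauchy[OF X f Xf, unfolded span_pair_hnorm_diff[OF XY XY]]]
    by blast
  have "ip M f (m i) = ip H g (k i)" if "i \<in> I" for i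
  proof (rule LIMSEQ_unique)
    show "(\<lambda>n. ip M (X n) (m i)) \<longlonglongrightarrow> ip M f (m i)"
      by (rule M.ip_tendsto_left[OF X f m_mem[OF that] Xf])
    show "(\<lambda>n. ip M (X n) (m i)) \<longlonglongrightarrow> ip H g (k i)"
      using H.ip_tendsto_left[OF Y g k_mem[OF that] Yg] span_pair_matches[OF XY] that
      by (simp add: matches_def)
  qed
  then have "matches f g"
    using f g by (simp add: matches_def)
  then show ?thesis
    using XY Xf Yg by (rule that)
qed

text \<open>Against pairs from the spans the identity is already exact, so only the second argument
  has to be approximated.\<close>

lemma matches_ip:
  assumes "matches f g" "matches f' g'"
  shows "ip M f f' = ip H g g'"
proof -
  have mem: "f \<in> vecs M" "g \<in> vecs H" "f' \<in> vecs M" "g' \<in> vecs H"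
    using assms by (auto simp: matches_def)
  obtain h X Y where h: "matches f' h" and XY: "\<And>n. span_pair (X n) (Y n)"
    and X: "(\<lambda>n. hnorm M (X n - f')) \<longlonglongrightarrow> 0" and Y: "(\<lambda>n. hnorm H (Y n - h)) \<longlonglongrightarrow> 0"
    using matches_approx[OF mem(3)] by blast
  have XYmem: "X n \<in> vecs M" "Y n \<in> vecs H" for n
    using span_pair_matches[OF XY] by (auto simp: matches_def)
  have "h = g'"
    using matches_unique[OF h assms(2)] .
  show ?thesis
  proof (rule LIMSEQ_unique)
    show "(\<lambda>n. ip M f (X n)) \<longlonglongrightarrow> ip M f f'"
      by (rule M.ip_tendsto_right[OF XYmem(1) mem(3,1) X])
    show "(\<lambda>n. ip M f (X n)) \<longlonglongrightarrow> ip H g g'"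
      unfolding matches_ip_span[OF XY assms(1)]
      by (rule H.ip_tendsto_right[OF XYmem(2) mem(4,2) Y[unfolded \<open>h = g'\<close>]])
  qed
qed

end

theorem equal_gram_unitary:
  assumes "equal_gram M H I m k"
  obtains U where "unitary_map M H U"
    "\<And>f i. f \<in> vecs M \<Longrightarrow> i \<in> I \<Longrightarrow> ip H (U f) (k i) = ip M f (m i)"
proof -
  interpret equal_gram M H I m k by fact
  \<comment> \<open>The hypotheses are symmetric in the two spaces; the reversed instance yields
    injectivity and surjectivity of \<open>U\<close>.\<close>
  interpret conv: equal_gram H M I k m
    by unfold_locales (simp_all add: k_mem m_mem gram total_k total_m)
  have conv: "conv.matches g f \<longleftrightarrow> matches f g" for f g
    by (auto simp: matches_def conv.matches_def)
  define U where "U f = (THE g. matches f g)" for f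
  have UI: "U f = g" if "matches f g" for f g
    unfolding U_def using that matches_unique by blast
  have U: "matches f (U f)" if f: "f \<in> vecs M" for f
  proof -
    obtain g where "matches f g"
      using matches_approx[OF f] .
    then show ?thesis
      by (simp add: UI)
  qed
  have Umem: "U f \<in> vecs H" if "f \<in> vecs M" for f
    using U[OF that] by (simp add: matches_def)
  have "bij_betw U (vecs M) (vecs H)"
  proof (rule bij_betwI')
    show "U f = U f' \<longleftrightarrow> f = f'" if "f \<in> vecs M" "f' \<in> vecs M" for f f'
      using conv.matches_unique[of "U f" f f'] U that by (auto simp: conv)
    show "\<exists>f\<in>vecs M. g = U f" if g: "g \<in> vecs H" for g
    proof -
      obtain f where "conv.matches g f"
        using conv.matches_approx[OF g] .
      then show ?thesis
        unfolding conv using UI by (auto simp: matches_def)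
    qed
  qed (rule Umem)
  moreover have "U (f + g) = U f + U g" if "f \<in> vecs M" "g \<in> vecs M" for f g
    using U[OF that(1)] U[OF that(2)]
    by (intro UI) (simp add: matches_def M.ip_add_left H.ip_add_left m_mem k_mem)
  moreover have "U (c *\<^sub>C f) = c *\<^sub>C U f" if "f \<in> vecs M" for c f
    using U[OF that] by (intro UI) (simp add: matches_def M.ip_scale_left H.ip_scale_left m_mem k_mem)
  moreover have "ip H (U f) (U g) = ip M f g" if "f \<in> vecs M" "g \<in> vecs M" for f g
    using matches_ip[OF U U] that by simp
  ultimately have "unitary_map M H U"
    by (simp add: unitary_map_def)
  moreover have "ip H (U f) (k i) = ip M f (m i)" if "f \<in> vecs M" "i \<in> I" for f i
    using U[OF that(1)] that(2) by (simp add: matches_def)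
  ultimately show ?thesis
    by (rule that)
qed

section \<open>Multivariate power series\<close>

definition monom_val :: "('d::finite \<Rightarrow> complex) \<Rightarrow> ('d \<Rightarrow> nat) \<Rightarrow> complex" where
  "monom_val x \<alpha> = (\<Prod>j\<in>UNIV. x j ^ \<alpha> j)"

lemma monom_val_fun_upd:
  assumes "\<alpha> k = 0"
  shows "monom_val x (\<alpha>(k := n)) = x k ^ n * monom_val x \<alpha>"
proof -
  have "(\<Prod>j\<in>UNIV - {k}. x j ^ (\<alpha>(k := n)) j) = (\<Prod>j\<in>UNIV - {k}. x j ^ \<alpha> j)"
    by (intro prod.cong) auto
  then show ?thesis
    using assms unfolding monom_val_def by (simp add: prod.remove[of UNIV k])
qed

lemma norm_monom_val: "of_real (cmod (monom_val x \<alpha>)) = monom_val (\<lambda>j. of_real (cmod (x j))) \<alpha>"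
  by (simp add: monom_val_def prod_norm[symmetric] norm_power)

text \<open>The coefficient of \<open>x^\<alpha>\<close> in
  \<open>(1 - (x_1 + ... + x_d))^(-a)\<close>. For \<open>a > 0\<close> its reciprocal is the
  squared norm of the monomial in the scalar module.\<close>

definition da_coeff :: "nat \<Rightarrow> ('d::finite \<Rightarrow> nat) \<Rightarrow> real" where
  "da_coeff a \<alpha> = pochhammer (real a) (\<Sum>j\<in>UNIV. \<alpha> j) / mfact \<alpha>"

lemma mfact_pos [simp]: "mfact \<alpha> > 0"
  by (simp add: mfact_def prod_pos)

lemma mfact_nonzero [simp]: "mfact \<alpha> \<noteq> 0"
  by (metis less_irrefl mfact_pos)

lemma pochhammer_nat_nonneg [simp]: "pochhammer (real a) n \<ge> 0"
  by (simp add: pochhammer_prod prod_nonneg)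

lemma da_coeff_nonneg [simp]: "da_coeff a \<alpha> \<ge> 0"
  by (simp add: da_coeff_def less_imp_le)

lemma sum_fun_upd:
  fixes \<alpha> :: "'d::finite \<Rightarrow> nat"
  assumes "\<alpha> k = 0"
  shows "(\<Sum>j\<in>UNIV. (\<alpha>(k := n)) j) = n + (\<Sum>j\<in>UNIV. \<alpha> j)"
proof -
  have "(\<Sum>j\<in>UNIV - {k}. (\<alpha>(k := n)) j) = (\<Sum>j\<in>UNIV - {k}. \<alpha> j)"
    by (intro sum.cong) auto
  then show ?thesis
    using assms by (simp add: sum.remove[of UNIV k])
qed

lemma mfact_fun_upd:
  assumes "\<alpha> k = 0"
  shows "mfact (\<alpha>(k := n)) = fact n * mfact \<alpha>"
proof -
  have "(\<Prod>j\<in>UNIV - {k}. fact ((\<alpha>(k := n)) j) :: real) = (\<Prod>j\<in>UNIV - {k}. fact (\<alpha> j))"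
    by (intro prod.cong) auto
  then show ?thesis
    using assms unfolding mfact_def by (simp add: prod.remove[of UNIV k])
qed

text \<open>The factorisation \<open>(a)_(n+m) = (a)_n (a+n)_m\<close> of rising factorials, the
  source of the exponent \<open>a + n\<close> once the variable \<open>k\<close> is split
  off.\<close>

lemma da_coeff_fun_upd:
  assumes "\<alpha> k = 0"
  shows "da_coeff a (\<alpha>(k := n)) = pochhammer (real a) n / fact n * da_coeff (a + n) \<alpha>"
  unfolding da_coeff_def sum_fun_upd[of \<alpha>, OF assms] mfact_fun_upd[of \<alpha>, OF assms]
  by (simp add: pochhammer_product')

lemma negative_binomial_has_sum:
  fixes y :: complex
  assumes "cmod y < 1"
  shows "((\<lambda>n. of_real (pochhammer (real a) n / fact n) * y ^ n) has_sum 1 / (1 - y) ^ a) UNIV"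
proof (rule norm_summable_imp_has_sum)
  \<comment> \<open>The signs of the binomial coefficient of \<open>-a\<close> and of the argument
    \<open>-z\<close> cancel. The identity is polymorphic because the real series at
    \<open>cmod y\<close> supplies absolute summability and the complex one the value.\<close>
  have eq: "((- of_nat a) gchoose n) * (- z) ^ n = pochhammer (of_nat a) n / fact n * z ^ n"
    for n and z :: "'c::field_char_0"
    unfolding gbinomial_pochhammer power_minus[of z] minus_minus
    by (simp add: field_simps flip: power_mult_distrib)
  have "(\<lambda>n. ((- real a) gchoose n) * (- cmod y) ^ n) sums (1 + - cmod y) powr (- real a)"
    using assms by (intro gen_binomial_real) simp
  then have "summable (\<lambda>n. pochhammer (real a) n / fact n * cmod y ^ n)"
    unfolding eq by (rule sums_summable)
  then show "summable (\<lambda>n. norm (complex_of_real (pochhammer (real a) n / fact n) * y ^ n))"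
    by (simp add: norm_mult norm_power norm_divide abs_mult)
  have "(\<lambda>n. ((- complex_of_nat a) gchoose n) * (- y) ^ n) sums (1 + - y) powr (- complex_of_nat a)"
    using assms by (intro gen_binomial_complex) simp
  moreover have "1 - y \<noteq> 0"
    using assms by auto
  ultimately show "(\<lambda>n. of_real (pochhammer (real a) n / fact n) * y ^ n) sums (1 / (1 - y) ^ a)"
    unfolding eq by (simp add: powr_minus powr_nat pochhammer_of_real[symmetric] divide_inverse)
qed

text \<open>Induction on the set \<open>J\<close> of variables that occur: splitting off the power \<open>n\<close> of one variable
  turns the exponent \<open>a\<close> for the remaining variables into \<open>a + n\<close>.\<close>

lemma negative_multinomial_has_sum_aux:
  fixes x :: "'d::finite \<Rightarrow> complex" and J :: "'d set"
  assumes "(\<Sum>j\<in>J. cmod (x j)) < 1"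
  shows "((\<lambda>\<alpha>. of_real (da_coeff a \<alpha>) * monom_val x \<alpha>) has_sum 1 / (1 - (\<Sum>j\<in>J. x j)) ^ a)
    {\<alpha>. \<forall>j. j \<notin> J \<longrightarrow> \<alpha> j = 0}"
  using finite[of J] assms
proof (induction J arbitrary: x a rule: finite_induct)
  case empty
  have "{\<alpha>::'d \<Rightarrow> nat. \<forall>j. j \<notin> {} \<longrightarrow> \<alpha> j = 0} = {\<lambda>_. 0}"
    by auto
  then show ?case
    by (intro has_sum_finiteI) (simp_all add: da_coeff_def mfact_def monom_val_def)
next
  case (insert k J)
  define B where "B = {\<alpha>::'d \<Rightarrow> nat. \<forall>j. j \<notin> J \<longrightarrow> \<alpha> j = 0}"
  define c where "c n = pochhammer (real a) n / fact n" for n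
  have c: "c n \<ge> 0" for n
    by (simp add: c_def)
  have Bk: "\<beta> k = 0" if "\<beta> \<in> B" for \<beta>
    using that insert.hyps by (auto simp: B_def)
  have inner: "((\<lambda>\<beta>. of_real (c n) * z k ^ n * (of_real (da_coeff (a + n) \<beta>) * monom_val z \<beta>)) has_sum
      of_real (c n) * z k ^ n * (1 / (1 - (\<Sum>j\<in>J. z j)) ^ (a + n))) B"
    if "(\<Sum>j\<in>J. cmod (z j)) < 1" for z n
    unfolding B_def by (intro has_sum_cmult_right insert.IH that)
  have outer: "((\<lambda>n. of_real (c n) * z k ^ n * (1 / (1 - (\<Sum>j\<in>J. z j)) ^ (a + n))) has_sum
      1 / (1 - (\<Sum>j\<in>insert k J. z j)) ^ a) UNIV"
    if z: "(\<Sum>j\<in>insert k J. cmod (z j)) < 1" for z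
  proof -
    \<comment> \<open>With \<open>s\<close> for the sum over \<open>J\<close>, the sum over
      \<open>n\<close> is a one-variable series in \<open>z k / (1 - s)\<close>, since
      \<open>1 - s - z_k = (1 - s) * (1 - z_k / (1 - s))\<close>.\<close>
    define s where "s = (\<Sum>j\<in>J. z j)"
    have zk: "cmod (z k) + (\<Sum>j\<in>J. cmod (z j)) < 1"
      using z insert.hyps by simp
    have "cmod s \<le> (\<Sum>j\<in>J. cmod (z j))"
      unfolding s_def by (rule norm_sum)
    moreover have "1 - cmod s \<le> cmod (1 - s)"
      using norm_triangle_ineq2[of 1 s] by simp
    ultimately have *: "cmod (z k) < cmod (1 - s)"
      using zk by linarith
    then have s: "1 - s \<noteq> 0"
      by auto
    have "cmod (z k / (1 - s)) < 1"
      using * by (simp add: norm_divide divide_less_eq_1)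
    from has_sum_cmult_right[OF negative_binomial_has_sum[OF this, of a], of "1 / (1 - s) ^ a"]
    have "((\<lambda>n. of_real (c n) * z k ^ n * (1 / (1 - s) ^ (a + n))) has_sum
        1 / (1 - s) ^ a * (1 / (1 - z k / (1 - s)) ^ a)) UNIV"
      by (rule has_sum_cong[THEN iffD1, rotated]) (simp add: c_def power_add power_divide)
    moreover have "1 / (1 - s) ^ a * (1 / (1 - z k / (1 - s)) ^ a) = 1 / (1 - (\<Sum>j\<in>insert k J. z j)) ^ a"
    proof -
      have "(1 - s) * (1 - z k / (1 - s)) = 1 - (\<Sum>j\<in>insert k J. z j)"
        using s insert.hyps by (simp add: right_diff_distrib s_def)
      then show ?thesis
        by (simp add: power_mult_distrib[symmetric])
    qed
    ultimately show ?thesis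
      by (simp add: s_def)
  qed
  \<comment> \<open>Evaluating both sums at the moduli of \<open>x\<close> gives absolute
    summability of the double series, which justifies summing over pairs.\<close>
  define y where "y j = complex_of_real (cmod (x j))" for j
  have y: "cmod (y j) = cmod (x j)" for j
    by (simp add: y_def)
  have "cmod (x k) + (\<Sum>j\<in>J. cmod (x j)) < 1"
    using insert.prems insert.hyps by simp
  then have xJ: "(\<Sum>j\<in>J. cmod (x j)) < 1"
    using norm_ge_zero[of "x k"] by linarith
  define f where "f = (\<lambda>(n, \<beta>). of_real (c n) * x k ^ n * (of_real (da_coeff (a + n) \<beta>) * monom_val x \<beta>))"
  define R where "R n = 1 / (1 - (\<Sum>j\<in>J. cmod (x j))) ^ (a + n)" for n
  have norm_inner: "((\<lambda>\<beta>. norm (f (n, \<beta>))) has_sum c n * cmod (x k) ^ n * R n) B" for n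
  proof -
    have "((\<lambda>\<beta>. complex_of_real (norm (f (n, \<beta>)))) has_sum of_real (c n * cmod (x k) ^ n * R n)) B"
      using inner[of y n] xJ c[of n]
      by (simp add: y f_def norm_mult norm_power norm_monom_val y_def[symmetric] R_def mult.assoc)
    then show ?thesis
      by (simp only: has_sum_of_real_iff)
  qed
  have norm_outer: "(\<lambda>n. c n * cmod (x k) ^ n * R n) summable_on UNIV"
  proof -
    have "((\<lambda>n. complex_of_real (c n * cmod (x k) ^ n * R n)) has_sum
        of_real (1 / (1 - (\<Sum>j\<in>insert k J. cmod (x j))) ^ a)) UNIV"
      using outer[of y] insert.prems by (simp add: y) (simp add: y_def R_def)
    then show ?thesis
      by (simp only: has_sum_of_real_iff has_sum_imp_summable)
  qed
  have "(\<lambda>p. norm (f p)) summable_on Sigma UNIV (\<lambda>_. B)"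
    unfolding Infinite_Sum.abs_summable_on_Sigma_iff
  proof (intro conjI ballI)
    show "(\<lambda>\<beta>. norm (f (n, \<beta>))) summable_on B" for n
      using norm_inner[of n] by (rule has_sum_imp_summable)
    have "(\<Sum>\<^sub>\<infinity>\<beta>\<in>B. norm (f (n, \<beta>))) = c n * cmod (x k) ^ n * R n" for n
      using norm_inner[of n] by (rule infsumI)
    moreover have "0 \<le> c n * cmod (x k) ^ n * R n" for n
      using c xJ by (simp add: R_def)
    ultimately show "(\<lambda>n. norm (\<Sum>\<^sub>\<infinity>\<beta>\<in>B. norm (f (n, \<beta>)))) summable_on UNIV"
      using norm_outer by simp
  qed
  then have "f summable_on Sigma UNIV (\<lambda>_. B)"
    by (rule abs_summable_summable)
  moreover have "((\<lambda>\<beta>. f (n, \<beta>)) has_sum of_real (c n) * x k ^ n * (1 / (1 - (\<Sum>j\<in>J. x j)) ^ (a + n))) B"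
    for n using inner[OF xJ, of n] by (simp add: f_def)
  ultimately have "(f has_sum 1 / (1 - (\<Sum>j\<in>insert k J. x j)) ^ a) (Sigma UNIV (\<lambda>_. B))"
    using outer[OF insert.prems] by (intro has_sum_SigmaI)
  moreover have "(f has_sum S) (Sigma UNIV (\<lambda>_. B)) \<longleftrightarrow>
      ((\<lambda>\<alpha>. of_real (da_coeff a \<alpha>) * monom_val x \<alpha>) has_sum S) {\<alpha>. \<forall>j. j \<notin> insert k J \<longrightarrow> \<alpha> j = 0}" for S
  proof (rule has_sum_reindex_bij_witness[where i = "\<lambda>\<alpha>. (\<alpha> k, \<alpha>(k := 0))" and j = "\<lambda>(n, \<beta>). \<beta>(k := n)"])
    show "(case p of (n, \<beta>) \<Rightarrow> \<beta>(k := n)) \<in> {\<alpha>. \<forall>j. j \<notin> insert k J \<longrightarrow> \<alpha> j = 0}"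
      if "p \<in> Sigma UNIV (\<lambda>_. B)" for p
      using that by (auto simp: B_def)
    show "(\<alpha> k, \<alpha>(k := 0)) \<in> Sigma UNIV (\<lambda>_. B)" if "\<alpha> \<in> {\<alpha>. \<forall>j. j \<notin> insert k J \<longrightarrow> \<alpha> j = 0}" for \<alpha>
      using that by (auto simp: B_def)
    show "of_real (da_coeff a (case p of (n, \<beta>) \<Rightarrow> \<beta>(k := n))) * monom_val x (case p of (n, \<beta>) \<Rightarrow> \<beta>(k := n)) = f p"
      if "p \<in> Sigma UNIV (\<lambda>_. B)" for p
      using that by (auto simp: f_def da_coeff_fun_upd monom_val_fun_upd Bk c_def)
  qed (auto simp: Bk fun_upd_idem)
  ultimately show ?case by blast
qed

lemma negative_multinomial_has_sum:
  fixes x :: "'d::finite \<Rightarrow> complex"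
  assumes "(\<Sum>j\<in>UNIV. cmod (x j)) < 1"
  shows "((\<lambda>\<alpha>. of_real (da_coeff a \<alpha>) * monom_val x \<alpha>) has_sum 1 / (1 - (\<Sum>j\<in>UNIV. x j)) ^ a) UNIV"
  using negative_multinomial_has_sum_aux[OF assms] by simp

section \<open>Power series that vanish identically\<close>

lemma power_series_coeff_zero:
  fixes b :: "nat \<Rightarrow> complex"
  assumes "r > 0" "\<And>t. cmod t < r \<Longrightarrow> (\<lambda>n. b n * t ^ n) sums 0"
  shows "b n = 0"
proof -
  define f where "f = Abs_fps b"
  have "summable (\<lambda>n. b n * of_real (r / 2) ^ n)"
    using assms(2)[of "of_real (r / 2)"] assms(1) by (intro sums_summable) auto
  then have "0 < fps_conv_radius f"
    using conv_radius_geI[of b "of_real (r / 2)"] assms(1)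
    by (simp add: fps_conv_radius_def f_def) (metis ereal_less(2) half_gt_zero less_le_trans)
  moreover have "eventually (\<lambda>t. eval_fps f t = eval_fps 0 t) (nhds 0)"
    unfolding eventually_nhds_metric
  proof (intro exI conjI allI impI)
    fix t :: complex assume "dist t 0 < r"
    then show "eval_fps f t = eval_fps 0 t"
      using assms(2)[of t] by (simp add: eval_fps_def f_def sums_iff)
  qed (fact assms(1))
  ultimately have "f = 0"
    by (intro eval_fps_eqD) auto
  then show ?thesis
    using fps_nth_Abs_fps[of b n] by (simp add: f_def)
qed

text \<open>The coefficients are isolated one variable at a time: if the sum over the exponents \<open>\<alpha>\<close> that
  agree with \<open>\<beta>\<close> on \<open>J\<close> vanishes identically, then so does the part with \<open>\<alpha> k = \<beta> k\<close>, being a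
  coefficient of a power series in the variable \<open>k\<close>.\<close>

lemma multi_power_series_coeff_zero:
  fixes g :: "('d::finite \<Rightarrow> nat) \<Rightarrow> complex"
  assumes "r > 0"
    and sum0: "\<And>w. (\<And>j. cmod (w j) < r) \<Longrightarrow> ((\<lambda>\<alpha>. g \<alpha> * monom_val w \<alpha>) has_sum 0) UNIV"
  shows "g \<beta> = 0"
proof -
  define A where "A J = {\<alpha>. \<forall>j\<in>J. \<alpha> j = \<beta> j}" for J
  have step: "\<forall>w. (\<forall>j. cmod (w j) < r) \<longrightarrow> ((\<lambda>\<alpha>. g \<alpha> * monom_val w \<alpha>) has_sum 0) (A J)" for J
    using finite[of J]
  proof (induction J rule: finite_induct)
    case empty
    then show ?case
      using sum0 by (simp add: A_def)
  next
    case (insert k J)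
    show ?case
    proof (intro allI impI)
      fix w :: "'d \<Rightarrow> complex" assume w: "\<forall>j. cmod (w j) < r"
      define An where "An n = {\<alpha> \<in> A J. \<alpha> k = n}" for n
      \<comment> \<open>\<open>h\<close> is the summand with the power of the variable
        \<open>k\<close> removed, hence independent of the value of that variable. Freeing the
        variable produces a power series in \<open>t\<close> with coefficients
        \<open>b n\<close>.\<close>
      define h where "h \<alpha> = g \<alpha> * monom_val w (\<alpha>(k := 0))" for \<alpha>
      have h: "g \<alpha> * monom_val (w(k := t)) \<alpha> = h \<alpha> * t ^ \<alpha> k" for t \<alpha>
      proof -
        have "monom_val (w(k := t)) (\<alpha>(k := 0)) = monom_val w (\<alpha>(k := 0))"
          unfolding monom_val_def by (intro prod.cong) auto
        then show ?thesis
          using monom_val_fun_upd[of "\<alpha>(k := 0)" k "w(k := t)" "\<alpha> k"] by (simp add: h_def mult_ac)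
      qed
      have J: "((\<lambda>\<alpha>. h \<alpha> * t ^ \<alpha> k) has_sum 0) (A J)" if "cmod t < r" for t
        using insert.IH[rule_format, of "w(k := t)"] w that by (simp add: h)
      \<comment> \<open>The point \<open>r / 2\<close> is nonzero and inside the disc of
        convergence: on \<open>An n\<close> its power is a constant factor that can be divided
        out.\<close>
      have "(\<lambda>\<alpha>. h \<alpha> * of_real (r / 2) ^ \<alpha> k) summable_on An n" for n
        using J[of "of_real (r / 2)"] assms(1)
        by (intro summable_on_subset_banach[OF has_sum_imp_summable]) (auto simp: An_def)
      then have "(\<lambda>\<alpha>. h \<alpha> * of_real (r / 2) ^ n) summable_on An n" for n
        by (rule summable_on_cong[THEN iffD1, rotated]) (simp add: An_def)
      then have hsum: "h summable_on An n" for n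
        using assms(1) summable_on_cmult_left[of "\<lambda>\<alpha>. h \<alpha> * of_real (r / 2) ^ n" "An n" "1 / of_real (r / 2) ^ n"]
        by simp
      define b where "b n = infsum h (An n)" for n
      have inner: "((\<lambda>\<alpha>. h \<alpha> * t ^ \<alpha> k) has_sum b n * t ^ n) (An n)" for n t
      proof -
        have "((\<lambda>\<alpha>. h \<alpha> * t ^ n) has_sum b n * t ^ n) (An n)"
          unfolding b_def by (intro has_sum_cmult_left has_sum_infsum hsum)
        then show ?thesis
          by (rule has_sum_cong[THEN iffD1, rotated]) (simp add: An_def)
      qed
      have "(\<lambda>n. b n * t ^ n) sums 0" if t: "cmod t < r" for t
      proof (rule has_sum_imp_sums, rule has_sum_SigmaD)
        have "((\<lambda>p. h (snd p) * t ^ (snd p) k) has_sum 0) (Sigma UNIV An) \<longleftrightarrow>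
            ((\<lambda>\<alpha>. h \<alpha> * t ^ \<alpha> k) has_sum 0) (A J)"
          by (rule has_sum_reindex_bij_witness[where i = "\<lambda>\<alpha>. (\<alpha> k, \<alpha>)" and j = snd])
            (auto simp: An_def)
        then show "((\<lambda>p. h (snd p) * t ^ (snd p) k) has_sum 0) (Sigma UNIV An)"
          using J[OF t] by blast
      qed (use inner in simp)
      then have b0: "b n = 0" for n
        by (rule power_series_coeff_zero[OF assms(1)])
      have "A (insert k J) = An (\<beta> k)"
        by (auto simp: A_def An_def)
      moreover have "g \<alpha> * monom_val w \<alpha> = h \<alpha> * w k ^ \<alpha> k" for \<alpha>
        using h[of \<alpha> "w k"] by simp
      ultimately show "((\<lambda>\<alpha>. g \<alpha> * monom_val w \<alpha>) has_sum 0) (A (insert k J))"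
        using inner[of "w k" "\<beta> k"] b0 by simp
    qed
  qed
  have "A UNIV = {\<beta>}"
    by (auto simp: A_def fun_eq_iff)
  then have "((\<lambda>\<alpha>. g \<alpha> * monom_val (\<lambda>_. of_real (r / 2)) \<alpha>) has_sum 0) {\<beta>}"
    using step[of UNIV, rule_format, of "\<lambda>_. of_real (r / 2)"] assms(1) by simp
  then have "g \<beta> * monom_val (\<lambda>_. of_real (r / 2)) \<beta> = 0"
    unfolding has_sum_finite_iff[OF finite.insertI[OF finite.emptyI]] by (metis sum.empty sum.insert_if finite.emptyI add.right_neutral empty_iff)
  then show ?thesis
    using assms(1) by (simp add: monom_val_def)
qed

section \<open>The scalar module\<close>

lemma mpow_eq_monom_val: "mpow z \<alpha> = monom_val (\<lambda>j. z $ j) \<alpha>"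
  by (simp add: mpow_def monom_val_def)

lemma sum_cmod_mult_less_1:
  fixes z w :: "complex ^ 'd::finite"
  assumes "z \<in> ball 0 1" "w \<in> ball 0 1"
  shows "(\<Sum>j\<in>UNIV. cmod (z $ j * cnj (w $ j))) < 1"
proof -
  have "(\<Sum>j\<in>UNIV. cmod (z $ j * cnj (w $ j))) \<le> norm z * norm w"
    using L2_set_mult_ineq[of "\<lambda>j. cmod (z $ j)" "\<lambda>j. cmod (w $ j)" UNIV]
    by (simp add: norm_mult norm_vec_def)
  also have "\<dots> < 1 * 1"
    using assms by (intro mult_strict_mono') auto
  finally show ?thesis by simp
qed

lemma DA_kernel_has_sum:
  fixes z w :: "complex ^ 'd::finite"
  assumes "z \<in> ball 0 1" "w \<in> ball 0 1"
  shows "((\<lambda>\<alpha>. of_real (da_coeff a \<alpha>) * mpow z \<alpha> * cnj (mpow w \<alpha>)) has_sum DA_kernel a z w 1) UNIV"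
proof -
  have "monom_val (\<lambda>j. z $ j * cnj (w $ j)) \<alpha> = mpow z \<alpha> * cnj (mpow w \<alpha>)" for \<alpha>
    by (simp add: monom_val_def mpow_def power_mult_distrib prod.distrib)
  then show ?thesis
    using negative_multinomial_has_sum[OF sum_cmod_mult_less_1[OF assms], of a]
    by (simp add: DA_kernel_def divide_inverse mult.assoc)
qed

text \<open>At depth 0 the factorial of the depth is 1 and the product is a rising factorial of
  \<open>a\<close>. So the root contributes exactly the kernel of the scalar module.\<close>

lemma scalar_kernel_zero:
  fixes z w :: "complex ^ 'd::finite"
  assumes "z \<in> ball 0 1" "w \<in> ball 0 1"
  shows "scalar_kernel a (\<lambda>_. 0) z w = DA_kernel a z w 1"
proof -
  have "mfact (\<lambda>_::'d. 0) / mfact \<alpha> * (\<Prod>i<(\<Sum>j\<in>UNIV. \<alpha> j). real ((\<Sum>j::'d\<in>UNIV. 0) + a + i))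
      = da_coeff a \<alpha>" for \<alpha> :: "'d \<Rightarrow> nat"
    by (simp add: da_coeff_def mfact_def[of "\<lambda>_. 0"] pochhammer_prod atLeast0LessThan)
  then show ?thesis
    unfolding scalar_kernel_def using infsumI[OF DA_kernel_has_sum[OF assms, of a]] by simp
qed

text \<open>At the origin only \<open>\<alpha> = 0\<close> contributes, with coefficient 1 for every
  depth \<open>\<delta>\<close>. So the tree kernel at \<open>(0, 0)\<close> fixes the vectors of
  each summand of \<open>E\<close>.\<close>

lemma scalar_kernel_at_0: "scalar_kernel a \<delta> 0 0 = 1"
proof -
  have mpow_0: "mpow 0 \<alpha> = (if \<alpha> = (\<lambda>_. 0) then 1 else 0)" for \<alpha> :: "'d::finite \<Rightarrow> nat"
    by (auto simp: mpow_def fun_eq_iff prod_zero_iff power_0_left)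
  have "((\<lambda>\<alpha>. of_real (mfact \<delta> / mfact (\<lambda>j. \<delta> j + \<alpha> j) *
        (\<Prod>i<(\<Sum>j\<in>UNIV. \<alpha> j). real ((\<Sum>j\<in>UNIV. \<delta> j) + a + i))) *
      mpow 0 \<alpha> * cnj (mpow 0 \<alpha>)) has_sum 1) UNIV"
    by (rule has_sum_finite_neutralI[of "{\<lambda>_. 0}"]) (auto simp: mpow_0)
  then show ?thesis
    unfolding scalar_kernel_def by (rule infsumI)
qed

section \<open>The sequence model of the scalar module\<close>

lemma da_coeff_pos: "a > 0 \<Longrightarrow> da_coeff a \<alpha> > 0"
  by (simp add: da_coeff_def pochhammer_pos)

text \<open>The space \<open>\<H>\<^sub>a\<close> is modelled on \<open>\<ell>\<^sup>2(\<nat>\<^sup>d)\<close>, whose standard basis corresponds to the normalised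
  monomials; \<open>da_vec a w\<close> corresponds to the kernel function at \<open>w\<close>.\<close>

definition da_vec :: "nat \<Rightarrow> complex ^ 'd::finite \<Rightarrow> ('d \<Rightarrow> nat) \<Rightarrow> complex" where
  "da_vec a w \<alpha> = of_real (sqrt (da_coeff a \<alpha>)) * cnj (mpow w \<alpha>)"

lemma da_vec_mult: "da_vec a w \<alpha> * cnj (da_vec a z \<alpha>) = of_real (da_coeff a \<alpha>) * mpow z \<alpha> * cnj (mpow w \<alpha>)"
proof -
  have "complex_of_real (sqrt (da_coeff a \<alpha>)) * of_real (sqrt (da_coeff a \<alpha>)) = of_real (da_coeff a \<alpha>)"
    by (simp flip: of_real_mult)
  then show ?thesis
    by (simp add: da_vec_def mult_ac)
qed

lemma da_vec_mem:
  assumes "w \<in> ball 0 1"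
  shows "da_vec a w \<in> vecs (l2 UNIV)"
proof -
  \<comment> \<open>On the diagonal the terms of the kernel expansion are squared moduli, so its
    summability is square summability.\<close>
  have "(\<lambda>\<alpha>. norm (da_vec a w \<alpha> * cnj (da_vec a w \<alpha>))) summable_on UNIV"
    using DA_kernel_has_sum[OF assms assms, of a] unfolding da_vec_mult
    by (simp add: summable_on_iff_abs_summable_on_complex[symmetric] has_sum_imp_summable)
  then show ?thesis
    by (simp add: l2_mem_iff norm_mult power2_eq_square)
qed

lemma ip_da_vec:
  assumes "w \<in> ball 0 1" "z \<in> ball 0 1"
  shows "ip (l2 UNIV) (da_vec a w) (da_vec a z) = DA_kernel a z w 1"
  unfolding ip_l2 da_vec_mult by (rule infsumI[OF DA_kernel_has_sum[OF assms(2,1)]])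

text \<open>As \<open>da_vec\<close> carries conjugated monomials, pairing with
  \<open>da_vec a w\<close> is a power series in \<open>w\<close> itself, with coefficients
  \<open>\<gamma> \<alpha> * sqrt (da_coeff a \<alpha>)\<close>. They vanish by uniqueness of
  coefficients, and the weights are positive because \<open>a > 0\<close>.\<close>

lemma da_vec_total:
  fixes \<gamma> :: "('d::finite \<Rightarrow> nat) \<Rightarrow> complex"
  assumes "a > 0" and \<gamma>: "\<gamma> \<in> vecs (l2 UNIV)"
    and orth: "\<And>w. w \<in> ball 0 1 \<Longrightarrow> ip (l2 UNIV) \<gamma> (da_vec a w) = 0"
  shows "\<gamma> = 0"
proof
  fix \<beta>
  have "\<gamma> \<beta> * of_real (sqrt (da_coeff a \<beta>)) = 0"
  \<comment> \<open>With this radius the polydisc lies in the unit ball, the norm being at most the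
    sum of the moduli of the coordinates.\<close>
  proof (rule multi_power_series_coeff_zero[where r = "1 / real CARD('d)"])
    fix w :: "'d \<Rightarrow> complex" assume w: "\<And>j. cmod (w j) < 1 / real CARD('d)"
    define v where "v = (\<chi> j. w j)"
    have "norm v \<le> (\<Sum>j\<in>UNIV. cmod (w j))"
      using L2_set_le_sum[of UNIV "\<lambda>j. cmod (w j)"] by (simp add: v_def norm_vec_def)
    also have "\<dots> < (\<Sum>j\<in>(UNIV::'d set). 1 / real CARD('d))"
      using w by (intro sum_strict_mono) auto
    finally have v: "v \<in> ball 0 1"
      by simp
    have "((\<lambda>\<alpha>. \<gamma> \<alpha> * cnj (da_vec a v \<alpha>)) has_sum 0) UNIV"
      using has_sum_infsum[OF l2_summable[OF \<gamma> da_vec_mem[OF v, of a]]] orth[OF v]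
      by (simp add: ip_l2)
    then show "((\<lambda>\<alpha>. \<gamma> \<alpha> * of_real (sqrt (da_coeff a \<alpha>)) * monom_val w \<alpha>) has_sum 0) UNIV"
      by (simp add: da_vec_def mpow_eq_monom_val v_def mult.assoc)
  qed simp
  then show "\<gamma> \<beta> = 0 \<beta>"
    using da_coeff_pos[OF assms(1), of \<beta>] by simp
qed

text \<open>Multiplication by \<open>z_k\<close> in normalised monomials: \<open>z_k * sqrt (c
  \<alpha>) * z^\<alpha> = sqrt (c \<alpha> / c \<beta>) * sqrt (c \<beta>) * z^\<beta>\<close>,
  where \<open>c\<close> is \<open>da_coeff a\<close> and \<open>\<beta>\<close> is
  \<open>\<alpha>\<close> raised by one at \<open>k\<close>.\<close>

definition da_shift :: "nat \<Rightarrow> 'd::finite \<Rightarrow> (('d \<Rightarrow> nat) \<Rightarrow> complex) \<Rightarrow> ('d \<Rightarrow> nat) \<Rightarrow> complex" where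
  "da_shift a k \<gamma> \<beta> = (if \<beta> k = 0 then 0 else
     of_real (sqrt (da_coeff a (\<beta>(k := \<beta> k - 1)) / da_coeff a \<beta>)) * \<gamma> (\<beta>(k := \<beta> k - 1)))"

lemma da_coeff_Suc:
  "da_coeff a (\<alpha>(k := Suc (\<alpha> k))) = da_coeff a \<alpha> * ((real a + real (\<Sum>j\<in>UNIV. \<alpha> j)) / (real (\<alpha> k) + 1))"
proof -
  define \<beta> where "\<beta> = \<alpha>(k := 0)"
  have \<beta>: "\<beta> k = 0" "\<alpha> = \<beta>(k := \<alpha> k)" "\<alpha>(k := Suc (\<alpha> k)) = \<beta>(k := Suc (\<alpha> k))"
    by (auto simp: \<beta>_def)
  have s: "(\<Sum>j\<in>UNIV. (\<alpha>(k := Suc (\<alpha> k))) j) = Suc (\<Sum>j\<in>UNIV. \<alpha> j)"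
    unfolding \<beta>(3) sum_fun_upd[of \<beta>, OF \<beta>(1)]
    using sum_fun_upd[of \<beta>, OF \<beta>(1), of "\<alpha> k", folded \<beta>(2)] by simp
  have m: "mfact (\<alpha>(k := Suc (\<alpha> k))) = (real (\<alpha> k) + 1) * mfact \<alpha>"
    unfolding \<beta>(3) mfact_fun_upd[of \<beta>, OF \<beta>(1)]
    using mfact_fun_upd[of \<beta>, OF \<beta>(1), of "\<alpha> k", folded \<beta>(2)] by simp
  show ?thesis
    unfolding da_coeff_def s m pochhammer_Suc by simp
qed

text \<open>The quotient \<open>(a + |\<alpha>|) / (\<alpha> k + 1)\<close> is at least 1 for
  \<open>a \<ge> 1\<close>. Hence all weights of \<open>da_shift\<close> are at most 1 and the shift
  is a contraction.\<close>

lemma da_coeff_mono: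
  assumes "a > 0"
  shows "da_coeff a \<alpha> \<le> da_coeff a (\<alpha>(k := Suc (\<alpha> k)))"
proof -
  have "\<alpha> k \<le> (\<Sum>j\<in>UNIV. \<alpha> j)"
    by (rule member_le_sum) auto
  then have "real (\<alpha> k) \<le> real (\<Sum>j\<in>UNIV. \<alpha> j)"
    by (rule of_nat_mono)
  moreover have "1 \<le> real a"
    using assms by simp
  ultimately have "1 \<le> (real a + real (\<Sum>j\<in>UNIV. \<alpha> j)) / (real (\<alpha> k) + 1)"
    by (simp add: le_divide_eq_1)
  from mult_left_mono[OF this da_coeff_nonneg[of a \<alpha>]] show ?thesis
    unfolding da_coeff_Suc by simp
qed

lemma da_shift_Suc:
  "da_shift a k \<gamma> (\<alpha>(k := Suc (\<alpha> k))) = of_real (sqrt (da_coeff a \<alpha> / da_coeff a (\<alpha>(k := Suc (\<alpha> k))))) * \<gamma> \<alpha>"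
  by (simp add: da_shift_def)

lemma range_fun_upd_Suc: "{\<beta>. \<beta> k \<noteq> 0} = range (\<lambda>\<alpha>. \<alpha>(k := Suc (\<alpha> k)))" for k :: 'd
proof (intro set_eqI iffI)
  fix \<beta> :: "'d \<Rightarrow> nat" assume "\<beta> \<in> {\<beta>. \<beta> k \<noteq> 0}"
  then show "\<beta> \<in> range (\<lambda>\<alpha>. \<alpha>(k := Suc (\<alpha> k)))"
    by (intro range_eqI[of _ _ "\<beta>(k := \<beta> k - 1)"]) auto
qed auto

lemma inj_fun_upd_Suc: "inj (\<lambda>\<alpha>. \<alpha>(k := Suc (\<alpha> k)))"
proof (rule injI)
  fix \<alpha> \<beta> :: "'a \<Rightarrow> nat" assume eq: "\<alpha>(k := Suc (\<alpha> k)) = \<beta>(k := Suc (\<beta> k))"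
  have "\<alpha> j = \<beta> j" for j
    using fun_cong[OF eq, of j] by (cases "j = k") auto
  then show "\<alpha> = \<beta>" by auto
qed

lemma da_shift_mem:
  fixes \<gamma> :: "('d::finite \<Rightarrow> nat) \<Rightarrow> complex"
  assumes "a > 0" "\<gamma> \<in> vecs (l2 UNIV)"
  shows "da_shift a k \<gamma> \<in> vecs (l2 UNIV)"
proof -
  have le: "cmod (da_shift a k \<gamma> (\<alpha>(k := Suc (\<alpha> k)))) \<le> cmod (\<gamma> \<alpha>)" for \<alpha>
  proof -
    have "sqrt (da_coeff a \<alpha> / da_coeff a (\<alpha>(k := Suc (\<alpha> k)))) \<le> 1"
      unfolding real_sqrt_le_1_iff divide_le_eq_1_pos[OF da_coeff_pos[OF assms(1)]]
      by (rule da_coeff_mono[OF assms(1)])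
    then show ?thesis
      unfolding da_shift_Suc norm_mult
      by (intro mult_left_le_one_le) (auto simp: less_imp_le)
  qed
  have "(\<lambda>\<alpha>. (cmod (\<gamma> \<alpha>))\<^sup>2) summable_on UNIV"
    using assms(2) by (simp add: l2_mem_iff)
  then have "(\<lambda>\<alpha>. (cmod (da_shift a k \<gamma> (\<alpha>(k := Suc (\<alpha> k)))))\<^sup>2) summable_on UNIV"
    by (rule summable_on_comparison_test) (intro power_mono le norm_ge_zero, rule zero_le_power2)
  then have "(\<lambda>\<beta>. (cmod (da_shift a k \<gamma> \<beta>))\<^sup>2) summable_on {\<beta>. \<beta> k \<noteq> 0}"
    unfolding range_fun_upd_Suc summable_on_reindex[OF inj_fun_upd_Suc] by (simp add: o_def)
  then have "(\<lambda>\<beta>. (cmod (da_shift a k \<gamma> \<beta>))\<^sup>2) summable_on UNIV"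
    by (rule summable_on_cong_neutral[THEN iffD1, rotated -1]) (auto simp: da_shift_def)
  then show ?thesis
    by (simp add: l2_mem_iff)
qed

text \<open>The inner product with \<open>da_vec a w\<close> will be the value at \<open>w\<close>
  of the function modelled by a sequence; this identity then turns the shift into multiplication by
  \<open>z_k\<close>.\<close>

lemma ip_da_shift:
  fixes \<gamma> :: "('d::finite \<Rightarrow> nat) \<Rightarrow> complex"
  assumes "a > 0" "\<gamma> \<in> vecs (l2 UNIV)" "w \<in> ball 0 1"
  shows "ip (l2 UNIV) (da_shift a k \<gamma>) (da_vec a w) = w $ k * ip (l2 UNIV) \<gamma> (da_vec a w)"
proof -
  have summand: "da_shift a k \<gamma> (\<alpha>(k := Suc (\<alpha> k))) * cnj (da_vec a w (\<alpha>(k := Suc (\<alpha> k)))) =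
      w $ k * (\<gamma> \<alpha> * cnj (da_vec a w \<alpha>))" for \<alpha>
  proof -
    define \<beta> where "\<beta> = \<alpha>(k := 0)"
    have \<beta>: "\<beta> k = 0" "\<alpha> = \<beta>(k := \<alpha> k)" "\<alpha>(k := Suc (\<alpha> k)) = \<beta>(k := Suc (\<alpha> k))"
      by (auto simp: \<beta>_def)
    have "mpow w (\<alpha>(k := Suc (\<alpha> k))) = w $ k * mpow w \<alpha>"
      unfolding mpow_eq_monom_val \<beta>(3) monom_val_fun_upd[of \<beta>, OF \<beta>(1)]
      using monom_val_fun_upd[of \<beta>, OF \<beta>(1), of _ "\<alpha> k", folded \<beta>(2)] by simp
    moreover have "sqrt (da_coeff a \<alpha> / da_coeff a (\<alpha>(k := Suc (\<alpha> k)))) *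
        sqrt (da_coeff a (\<alpha>(k := Suc (\<alpha> k)))) = sqrt (da_coeff a \<alpha>)"
      using da_coeff_pos[OF assms(1), of "\<alpha>(k := Suc (\<alpha> k))"] by (simp flip: real_sqrt_mult)
    then have "complex_of_real (sqrt (da_coeff a \<alpha> / da_coeff a (\<alpha>(k := Suc (\<alpha> k))))) *
        of_real (sqrt (da_coeff a (\<alpha>(k := Suc (\<alpha> k))))) = of_real (sqrt (da_coeff a \<alpha>))"
      by (simp flip: of_real_mult)
    ultimately show ?thesis
      unfolding da_shift_Suc da_vec_def by (simp add: mult_ac)
  qed
  have "ip (l2 UNIV) (da_shift a k \<gamma>) (da_vec a w) =
      (\<Sum>\<^sub>\<infinity>\<beta>\<in>{\<beta>. \<beta> k \<noteq> 0}. da_shift a k \<gamma> \<beta> * cnj (da_vec a w \<beta>))"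
    unfolding ip_l2 by (rule infsum_cong_neutral) (auto simp: da_shift_def)
  also have "\<dots> = (\<Sum>\<^sub>\<infinity>\<alpha>. w $ k * (\<gamma> \<alpha> * cnj (da_vec a w \<alpha>)))"
    unfolding range_fun_upd_Suc infsum_reindex[OF inj_fun_upd_Suc] by (simp add: o_def summand)
  also have "\<dots> = w $ k * ip (l2 UNIV) \<gamma> (da_vec a w)"
    unfolding ip_l2 by (intro infsum_cmult_right l2_summable da_vec_mem assms)
  finally show ?thesis .
qed

definition ball_fun :: "(complex ^ 'd::finite \<Rightarrow> 'e::zero) \<Rightarrow> complex ^ 'd \<Rightarrow> 'e" where
  "ball_fun f z = (if z \<in> ball 0 1 then f z else 0)"

locale DA_module =
  fixes a :: nat and HA :: "(complex ^ 'd::finite \<Rightarrow> complex) hilbert"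
  assumes a_pos: "a > 0" and DA: "is_DA_module a HA"
begin

sublocale HA: hilbert_structure HA
  using DA by unfold_locales (simp add: is_DA_module_def holomorphic_rkhs_def)

lemma HA_outside: "f \<in> vecs HA \<Longrightarrow> z \<notin> ball 0 1 \<Longrightarrow> f z = 0"
  using DA by (simp add: is_DA_module_def holomorphic_rkhs_def)

abbreviation kern :: "complex ^ 'd \<Rightarrow> complex ^ 'd \<Rightarrow> complex" where
  "kern w \<equiv> ball_fun (\<lambda>z. DA_kernel a z w 1)"

lemma kern_mem: "w \<in> ball 0 1 \<Longrightarrow> kern w \<in> vecs HA"
  and ip_kern: "w \<in> ball 0 1 \<Longrightarrow> f \<in> vecs HA \<Longrightarrow> ip HA f (kern w) = f w"
  using DA unfolding is_DA_module_def holomorphic_rkhs_def ball_fun_def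
  by (simp_all add: complex_hilbert_def)

lemma kern_total:
  assumes "f \<in> vecs HA" "\<forall>w\<in>ball 0 1. ip HA f (kern w) = 0"
  shows "f = 0"
proof
  fix z show "f z = 0 z"
    using assms ip_kern[of z f] HA_outside[of f z] by (cases "z \<in> ball 0 1") auto
qed

lemma ip_kern_kern: "w \<in> ball 0 1 \<Longrightarrow> z \<in> ball 0 1 \<Longrightarrow> ip HA (kern w) (kern z) = DA_kernel a z w 1"
  using ip_kern[of z "kern w"] kern_mem[of w] by (simp add: ball_fun_def)

text \<open>The kernel functions and the \<open>da_vec a w\<close> share the Gram matrix given by
  the kernel expansion. Pairing with a kernel function evaluates, so the unitary is known value by
  value, and the shift relation can be checked pointwise.\<close>

lemma model:
  obtains W where "unitary_map (l2 UNIV) HA W"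
    "\<And>\<gamma> w. \<gamma> \<in> vecs (l2 UNIV) \<Longrightarrow> w \<in> ball 0 1 \<Longrightarrow> W \<gamma> w = ip (l2 UNIV) \<gamma> (da_vec a w)"
    "\<And>k \<gamma>. \<gamma> \<in> vecs (l2 UNIV) \<Longrightarrow> mult_coord k (W \<gamma>) = W (da_shift a k \<gamma>)"
proof -
  have "equal_gram (l2 UNIV) HA (ball 0 1) (da_vec a) kern"
  proof unfold_locales
    show "\<gamma> = 0" if "\<gamma> \<in> vecs (l2 UNIV)" "\<forall>w\<in>ball 0 1. ip (l2 UNIV) \<gamma> (da_vec a w) = 0"
      for \<gamma> :: "('d \<Rightarrow> nat) \<Rightarrow> complex"
      using da_vec_total[OF a_pos that(1)] that(2) by simp
  qed (use kern_total in \<open>auto simp: kern_mem da_vec_mem ip_kern_kern ip_da_vec simp del: mem_ball\<close>)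
  then obtain W where W: "unitary_map (l2 UNIV) HA W"
    and Wip: "\<And>\<gamma> w. \<gamma> \<in> vecs (l2 UNIV) \<Longrightarrow> w \<in> ball 0 1 \<Longrightarrow>
      ip HA (W \<gamma>) (kern w) = ip (l2 UNIV) \<gamma> (da_vec a w)"
    by (rule equal_gram_unitary) blast
  have WH: "W \<gamma> \<in> vecs HA" if "\<gamma> \<in> vecs (l2 UNIV)" for \<gamma>
    using W that by (auto simp: unitary_map_def bij_betw_def)
  have Wval: "W \<gamma> w = ip (l2 UNIV) \<gamma> (da_vec a w)" if "\<gamma> \<in> vecs (l2 UNIV)" "w \<in> ball 0 1" for \<gamma> w
    using Wip[OF that] ip_kern[OF that(2) WH[OF that(1)]] by simp
  have "mult_coord k (W \<gamma>) w = W (da_shift a k \<gamma>) w" if \<gamma>: "\<gamma> \<in> vecs (l2 UNIV)" for k \<gamma> w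
  proof (cases "w \<in> ball 0 1")
    case True
    then show ?thesis
      unfolding mult_coord_def Wval[OF \<gamma> True] Wval[OF da_shift_mem[OF a_pos \<gamma>] True]
      using ip_da_shift[OF a_pos \<gamma> True] by simp
  next
    case False
    then show ?thesis
      unfolding mult_coord_def
      using HA_outside[OF WH[OF \<gamma>] False] HA_outside[OF WH[OF da_shift_mem[OF a_pos \<gamma>]] False]
      by simp
  qed
  then show ?thesis
    using that[OF W Wval] by blast
qed

lemma coord_invariant: "coord_invariant HA"
  unfolding coord_invariant_def
proof (intro allI ballI)
  fix k f assume "f \<in> vecs HA"
  obtain W where W: "unitary_map (l2 UNIV) HA W"
    and shift: "\<And>k \<gamma>. \<gamma> \<in> vecs (l2 UNIV) \<Longrightarrow> mult_coord k (W \<gamma>) = W (da_shift a k \<gamma>)"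
    by (rule model) blast
  obtain \<gamma> where "\<gamma> \<in> vecs (l2 UNIV)" "f = W \<gamma>"
    using W \<open>f \<in> vecs HA\<close> unfolding unitary_map_def bij_betw_def by blast
  then show "mult_coord k f \<in> vecs HA"
    using shift da_shift_mem[OF a_pos, of \<gamma> k] W unfolding unitary_map_def bij_betw_def by auto
qed

text \<open>In the sequence model each unit vector at a nonzero multi-index is a positive multiple
  of a shifted unit vector, so a vector orthogonal to all \<open>z_k h\<close> lives at the zero
  multi-index alone. The resulting one-dimensionality is phrased by orthogonality, ready to be
  tested on two given vectors.\<close>

lemma orthogonal_to_coord_multiples:
  assumes f: "f \<in> vecs HA" "\<And>k h. h \<in> vecs HA \<Longrightarrow> ip HA f (mult_coord k h) = 0"
    and g: "g \<in> vecs HA" "\<And>k h. h \<in> vecs HA \<Longrightarrow> ip HA g (mult_coord k h) = 0"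
    and "ip HA f g = 0"
  shows "f = 0 \<or> g = 0"
proof -
  obtain W where W: "unitary_map (l2 UNIV) HA W"
    and shift: "\<And>k \<gamma>. \<gamma> \<in> vecs (l2 UNIV) \<Longrightarrow> mult_coord k (W \<gamma>) = W (da_shift a k \<gamma>)"
    by (rule model) blast
  have WH: "W \<gamma> \<in> vecs HA" if "\<gamma> \<in> vecs (l2 UNIV)" for \<gamma>
    using W that by (auto simp: unitary_map_def bij_betw_def)
  have surj: "\<exists>\<gamma>\<in>vecs (l2 UNIV). h = W \<gamma>" if "h \<in> vecs HA" for h
    using W that unfolding unitary_map_def bij_betw_def by blast
  have Wip: "ip HA (W \<gamma>) (W \<gamma>') = ip (l2 UNIV) \<gamma> \<gamma>'"
    if "\<gamma> \<in> vecs (l2 UNIV)" "\<gamma>' \<in> vecs (l2 UNIV)" for \<gamma> \<gamma>'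
    using W that by (simp add: unitary_map_def)
  have vanish: "\<gamma> \<beta> = 0"
    if \<gamma>: "\<gamma> \<in> vecs (l2 UNIV)" "\<And>k h. h \<in> vecs HA \<Longrightarrow> ip HA (W \<gamma>) (mult_coord k h) = 0"
      and \<beta>: "\<beta> \<noteq> (\<lambda>_. 0)" for \<gamma> \<beta>
  proof -
    obtain k where k: "\<beta> k \<noteq> 0"
      using \<beta> by auto
    then obtain \<alpha> where \<alpha>: "\<beta> = \<alpha>(k := Suc (\<alpha> k))"
      using range_fun_upd_Suc[of k] by blast
    \<comment> \<open>The test vector is the unit vector one step below \<open>\<beta>\<close> in
      direction \<open>k\<close>; its shift is \<open>r\<close> times the unit vector at
      \<open>\<beta>\<close>.\<close>
    define \<delta> :: "('d \<Rightarrow> nat) \<Rightarrow> complex" where "\<delta> x = (if x = \<alpha> then 1 else 0)" for x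
    define r where "r = sqrt (da_coeff a \<alpha> / da_coeff a \<beta>)"
    have r: "r > 0"
      using divide_pos_pos[OF da_coeff_pos[OF a_pos] da_coeff_pos[OF a_pos]] by (simp add: r_def)
    have "\<delta> \<in> vecs (l2 UNIV)"
      unfolding l2_mem_iff
      by (auto intro!: finite_nonzero_values_imp_summable_on finite_subset[of _ "{\<alpha>}"]
          simp: \<delta>_def split: if_splits)
    then have "ip (l2 UNIV) \<gamma> (da_shift a k \<delta>) = 0"
      using \<gamma>(2)[OF WH, of \<delta> k] Wip[OF \<gamma>(1) da_shift_mem[OF a_pos]] by (simp add: shift)
    moreover have "da_shift a k \<delta> x = (if x = \<beta> then of_real r else 0)" for x
    proof (cases "x k = 0")
      case True
      then show ?thesis using k by (auto simp: da_shift_def)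
    next
      case False
      then obtain y where y: "x = y(k := Suc (y k))"
        using range_fun_upd_Suc[of k] by blast
      have "x = \<beta> \<longleftrightarrow> y = \<alpha>"
        unfolding y \<alpha> using inj_fun_upd_Suc[of k] by (auto dest: injD)
      then show ?thesis
        unfolding y da_shift_Suc by (auto simp: \<delta>_def r_def \<alpha>)
    qed
    then have "ip (l2 UNIV) \<gamma> (da_shift a k \<delta>) = \<gamma> \<beta> * of_real r"
      unfolding ip_l2 by (intro infsumI has_sum_finite_neutralI[of "{\<beta>}"]) auto
    ultimately show ?thesis
      using r by simp
  qed
  obtain \<gamma> \<gamma>' where \<gamma>: "\<gamma> \<in> vecs (l2 UNIV)" "f = W \<gamma>" and \<gamma>': "\<gamma>' \<in> vecs (l2 UNIV)" "g = W \<gamma>'"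
    using surj[OF f(1)] surj[OF g(1)] by blast
  have \<gamma>0: "\<gamma> \<beta> = 0" and \<gamma>'0: "\<gamma>' \<beta> = 0" if "\<beta> \<noteq> (\<lambda>_. 0)" for \<beta>
    using vanish[OF \<gamma>(1)] vanish[OF \<gamma>'(1)] f(2) g(2) that unfolding \<gamma>(2) \<gamma>'(2) by blast+
  have "ip (l2 UNIV) \<gamma> \<gamma>' = \<gamma> (\<lambda>_. 0) * cnj (\<gamma>' (\<lambda>_. 0))"
    unfolding ip_l2 by (intro infsumI has_sum_finite_neutralI[of "{\<lambda>_. 0}"]) (auto simp: \<gamma>0)
  then have "\<gamma> (\<lambda>_. 0) = 0 \<or> \<gamma>' (\<lambda>_. 0) = 0"
    using assms(5) Wip[OF \<gamma>(1) \<gamma>'(1)] \<gamma>(2) \<gamma>'(2) by simp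
  then have "\<gamma> = 0 \<or> \<gamma>' = 0"
    using \<gamma>0 \<gamma>'0 by (metis ext zero_fun_apply)
  moreover have "ip HA f f = ip (l2 UNIV) \<gamma> \<gamma>" "ip HA g g = ip (l2 UNIV) \<gamma>' \<gamma>'"
    using Wip \<gamma> \<gamma>' by auto
  ultimately show ?thesis
    using f(1) g(1) by (metis HA.ip_self_eq_0 l2.ip_self_eq_0 \<gamma>(1) \<gamma>'(1))
qed

end

section \<open>Rooted trees and the joint kernel\<close>

locale rooted_tree =
  fixes G :: "'v dgraph"
  assumes rooted_directed_tree: "rooted_directed_tree G"
begin

lemma edge_verts: "(u, v) \<in> edges G \<Longrightarrow> u \<in> verts G \<and> v \<in> verts G"
  using rooted_directed_tree unfolding rooted_directed_tree_def by blast

lemma acyclic_edges: "acyclic (edges G)"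
  using rooted_directed_tree unfolding rooted_directed_tree_def by (elim conjE)

lemma parent_unique: "(u, v) \<in> edges G \<Longrightarrow> (u', v) \<in> edges G \<Longrightarrow> u = u'"
  using rooted_directed_tree unfolding rooted_directed_tree_def by (elim conjE) blast

lemma ex1_root: "\<exists>!r. r \<in> verts G \<and> no_parent G r"
  using rooted_directed_tree unfolding rooted_directed_tree_def by (elim conjE)

lemma connected: "u \<in> verts G \<Longrightarrow> v \<in> verts G \<Longrightarrow> (u, v) \<in> (edges G \<union> (edges G)\<inverse>)\<^sup>*"
  using rooted_directed_tree unfolding rooted_directed_tree_def by (elim conjE) blast

lemma root_in_verts [simp]: "tree_root G \<in> verts G"
  and no_parent_root: "no_parent G (tree_root G)"
  using theI'[OF ex1_root] unfolding tree_root_def by auto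

lemma root_not_child [simp]: "(u, tree_root G) \<notin> edges G"
  using no_parent_root by (simp add: no_parent_def)

lemma ex_parent: "v \<in> verts G \<Longrightarrow> v \<noteq> tree_root G \<Longrightarrow> \<exists>p. (p, v) \<in> edges G"
  using ex1_root root_in_verts no_parent_root unfolding no_parent_def by metis

lemma par_eq: "(p, v) \<in> edges G \<Longrightarrow> par G v = p"
  unfolding par_def using parent_unique by blast

lemma sib_eq: "(p, v) \<in> edges G \<Longrightarrow> sib G v = Chi G p"
  by (simp add: sib_def par_eq)

lemma mem_sibD:
  assumes "v \<in> verts G" "v \<noteq> tree_root G" "w \<in> sib G v"
  shows "w \<in> verts G" "w \<noteq> tree_root G" "sib G w = sib G v"
proof -
  obtain p where p: "(p, v) \<in> edges G"
    using ex_parent assms by blast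
  then have "(p, w) \<in> edges G"
    using assms(3) by (simp add: sib_eq Chi_def)
  then show "w \<in> verts G" "w \<noteq> tree_root G" "sib G w = sib G v"
    using edge_verts sib_eq p by auto
qed

lemma self_mem_sib: "v \<in> verts G \<Longrightarrow> v \<noteq> tree_root G \<Longrightarrow> v \<in> sib G v"
  using ex_parent[of v] by (auto simp: sib_eq Chi_def)

lemma depth_root: "depth G (tree_root G) = 0"
  unfolding depth_def
proof (rule the_equality)
  show "n = 0" if "(tree_root G, tree_root G) \<in> edges G ^^ n" for n
    using that by (cases n) auto
qed simp

text \<open>Connectedness gives only an undirected path. On a backward step from \<open>y\<close> to
  \<open>z\<close>, the directed path from the root to \<open>y\<close> must end with the edge from
  the unique parent \<open>z\<close>, and dropping this edge leaves a path to
  \<open>z\<close>.\<close>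

lemma descendant_of_root:
  assumes "v \<in> verts G"
  shows "(tree_root G, v) \<in> (edges G)\<^sup>*"
  using connected[OF root_in_verts assms]
proof (induction rule: rtrancl_induct)
  case (step y z)
  show ?case
  proof (cases "(y, z) \<in> edges G")
    case False
    then have zy: "(z, y) \<in> edges G"
      using step.hyps(2) by auto
    then have "y \<noteq> tree_root G"
      by auto
    then obtain p where "(tree_root G, p) \<in> (edges G)\<^sup>*" "(p, y) \<in> edges G"
      using step.IH by (metis rtranclE)
    then show ?thesis
      using parent_unique[OF zy] by blast
  qed (use step.IH in auto)
qed simp

text \<open>The unique child can be iterated from the root: acyclicity makes the iterates distinct,
  and descent of every vertex from the root makes them exhaust the tree.\<close>

lemma iso_nat_tree_if_not_branching:
  assumes "leafless G" "branching_vertices G = {}"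
  shows "dgraph_iso G nat_tree"
proof -
  define nxt where "nxt u = (SOME v. (u, v) \<in> edges G)" for u
  have nxt: "(u, nxt u) \<in> edges G" if "u \<in> verts G" for u
    using assms(1) that unfolding nxt_def leafless_def Chi_def by (auto intro: someI)
  have nxt_unique: "v = nxt u" if "(u, v) \<in> edges G" for u v
  proof -
    have "u \<in> verts G"
      using edge_verts that by blast
    then show ?thesis
      using assms(2) nxt[of u] that unfolding branching_vertices_def Chi_def by blast
  qed
  define \<phi> where "\<phi> n = (nxt ^^ n) (tree_root G)" for n
  have \<phi>_verts: "\<phi> n \<in> verts G" for n
    by (induction n) (use nxt edge_verts in \<open>auto simp: \<phi>_def\<close>)
  have \<phi>_Suc: "\<phi> (Suc n) = nxt (\<phi> n)" for n
    by (simp add: \<phi>_def)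
  have "(\<phi> m, \<phi> (Suc (m + k))) \<in> (edges G)\<^sup>+" for m k
  proof (induction k)
    case 0
    then show ?case
      using nxt[OF \<phi>_verts] by (auto simp: \<phi>_Suc)
  next
    case (Suc k)
    then show ?case
      using nxt[OF \<phi>_verts, of "Suc (m + k)"] by (simp add: \<phi>_Suc trancl.trancl_into_trancl)
  qed
  then have "\<phi> m \<noteq> \<phi> n" if "m < n" for m n
    using acyclic_edges less_imp_Suc_add[OF that] unfolding acyclic_def by metis
  then have inj: "inj \<phi>"
    by (metis injI linorder_neqE_nat)
  have "v \<in> range \<phi>" if "v \<in> verts G" for v
    using descendant_of_root[OF that]
  proof (induction rule: rtrancl_induct)
    case base
    have "tree_root G = \<phi> 0"
      by (simp add: \<phi>_def)
    then show ?case by blast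
  next
    case (step y z)
    then obtain n where "y = \<phi> n" by blast
    then have "z = \<phi> (Suc n)"
      using step.hyps(2) nxt_unique by (simp add: \<phi>_Suc)
    then show ?case by blast
  qed
  then have bij: "bij_betw \<phi> UNIV (verts G)"
    using inj \<phi>_verts by (auto simp: bij_betw_def)
  have edge: "(\<phi> m, \<phi> n) \<in> edges G \<longleftrightarrow> n = Suc m" for m n
    using nxt_unique nxt[OF \<phi>_verts, of m] inj by (metis \<phi>_Suc injD)
  show ?thesis
    unfolding dgraph_iso_def
  proof (intro exI conjI ballI)
    show "bij_betw (inv \<phi>) (verts G) (verts nat_tree)"
      using bij_betw_inv_into[OF bij] by (simp add: nat_tree_def)
    fix u v assume "u \<in> verts G" "v \<in> verts G"
    then obtain m n where "u = \<phi> m" "v = \<phi> n"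
      using bij unfolding bij_betw_def by (metis imageE)
    then show "(u, v) \<in> edges G \<longleftrightarrow> (inv \<phi> u, inv \<phi> v) \<in> edges nat_tree"
      using inj by (simp add: edge nat_tree_def inv_f_f)
  qed
qed

lemma not_branching_if_iso_nat_tree:
  assumes "dgraph_iso G nat_tree"
  shows "branching_vertices G = {}"
proof -
  obtain \<phi> where bij: "bij_betw \<phi> (verts G) UNIV"
    and edge: "\<And>u v. u \<in> verts G \<Longrightarrow> v \<in> verts G \<Longrightarrow> (u, v) \<in> edges G \<longleftrightarrow> \<phi> v = Suc (\<phi> u)"
    using assms unfolding dgraph_iso_def nat_tree_def by auto
  have "v = w" if "(u, v) \<in> edges G" "(u, w) \<in> edges G" for u v w
    using that edge_verts[OF that(1)] edge_verts[OF that(2)] edge bij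
    by (metis bij_betw_def inj_onD)
  then show ?thesis
    by (auto simp: branching_vertices_def Chi_def)
qed

end

lemma l2_superset:
  assumes "f \<in> vecs (l2 X)" "X \<subseteq> Y"
  shows "f \<in> vecs (l2 Y)"
proof -
  have "(\<lambda>x. (cmod (f x))\<^sup>2) summable_on X \<longleftrightarrow> (\<lambda>x. (cmod (f x))\<^sup>2) summable_on Y"
    by (rule summable_on_cong_neutral) (use assms in \<open>auto simp: l2_mem_iff\<close>)
  then show ?thesis
    using assms by (auto simp: l2_mem_iff)
qed

lemma l2_finite_support:
  assumes "finite S" "S \<subseteq> X" "\<And>x. x \<notin> S \<Longrightarrow> f x = 0"
  shows "f \<in> vecs (l2 X)"
proof -
  have "{x \<in> X. (cmod (f x))\<^sup>2 \<noteq> 0} \<subseteq> S"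
  proof
    fix x assume "x \<in> {x \<in> X. (cmod (f x))\<^sup>2 \<noteq> 0}"
    then show "x \<in> S"
      using assms(3)[of x] by (cases "x \<in> S") auto
  qed
  then have "(\<lambda>x. (cmod (f x))\<^sup>2) summable_on X"
    using assms(1) finite_subset by (intro finite_nonzero_values_imp_summable_on) blast
  then show ?thesis
    using assms(2,3) by (auto simp: l2_mem_iff)
qed

lemma sum_fun_apply: "(\<Sum>i\<in>A. f i) x = (\<Sum>i\<in>A. f i x)"
  by (induction A rule: infinite_finite_induct) auto

locale tree_product =
  fixes T :: "'d::finite \<Rightarrow> 'v dgraph" and \<Omega> :: "'d set \<Rightarrow> ('d \<Rightarrow> 'v) set" and a :: nat
  assumes trees: "\<And>j. rooted_directed_tree (T j)"
    and leafless: "\<And>j. leafless (T j)"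
    and locally_finite: "\<And>j. locally_finite (T j)"
    and transversal: "sib_transversal T \<Omega>"
    and a_pos: "a > 0"
begin

sublocale tree: rooted_tree "T j" for j
  by unfold_locales (rule trees)

abbreviation V :: "('d \<Rightarrow> 'v) set" where
  "V \<equiv> verts (cart_prod T)"

abbreviation rt :: "'d \<Rightarrow> 'v" where
  "rt \<equiv> \<lambda>j. tree_root (T j)"

lemma V_iff: "v \<in> V \<longleftrightarrow> (\<forall>j. v j \<in> verts (T j))"
  by (simp add: cart_prod_def Let_def)

lemma rt_in_V [simp]: "rt \<in> V"
  by (simp add: V_iff)

section \<open>Sibling classes, the spaces \<open>L_space\<close> and their projections\<close>

lemma sib_setD:
  assumes "u \<in> Phi T F" "w \<in> sib_set T F u"
  shows "w \<in> Phi T F" "sib_set T F w = sib_set T F u"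
proof -
  have w: "w j \<noteq> rt j \<and> sib (T j) (w j) = sib (T j) (u j)" if "j \<in> F" for j
    using that assms tree.mem_sibD[of "u j" j "w j"] by (auto simp: Phi_def sib_set_def V_iff)
  have w': "w j = u j" if "j \<notin> F" for j
    using that assms by (auto simp: sib_set_def)
  show "w \<in> Phi T F"
    using assms w w' by (auto simp: Phi_def sib_set_def)
  show "sib_set T F w = sib_set T F u"
    using w w' by (simp add: sib_set_def cong: if_cong)
qed

lemma self_mem_sib_set: "u \<in> Phi T F \<Longrightarrow> u \<in> sib_set T F u"
  by (auto simp: sib_set_def Phi_def V_iff intro: tree.self_mem_sib)

lemma Phi_disjoint: "v \<in> Phi T F \<Longrightarrow> v \<in> Phi T F' \<Longrightarrow> F = F'"
  unfolding Phi_def by (auto split: if_splits)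

lemma Omega_Phi: "u \<in> \<Omega> F \<Longrightarrow> u \<in> Phi T F"
  using transversal by (auto simp: sib_transversal_def)

text \<open>The non-root coordinates of the common vertex \<open>v\<close> determine
  \<open>F\<close>, and the class of \<open>v\<close> meets the transversal once. Hence different
  spaces \<open>L_space\<close> have disjoint supports and are orthogonal.\<close>

lemma Omega_unique:
  assumes "u \<in> \<Omega> F" "u' \<in> \<Omega> F'" "v \<in> sib_set T F u" "v \<in> sib_set T F' u'"
  shows "F = F' \<and> u = u'"
proof -
  have v: "v \<in> Phi T F" "v \<in> Phi T F'"
    using sib_setD(1) assms Omega_Phi by blast+
  then have F: "F' = F"
    using Phi_disjoint by blast
  have "u \<in> sib_set T F v" "u' \<in> sib_set T F v"
    using assms self_mem_sib_set Omega_Phi sib_setD(2) unfolding F by blast+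
  then have "u = u'"
    using transversal v(1) assms(1,2) unfolding F sib_transversal_def by blast
  then show ?thesis
    using F by simp
qed

lemma Omega_empty: "\<Omega> {} = {rt}"
proof -
  have Phi: "Phi T {} = {rt}"
    by (auto simp: Phi_def V_iff)
  then have "\<exists>!w. w \<in> \<Omega> {} \<and> w \<in> sib_set T {} rt"
    using transversal unfolding sib_transversal_def by blast
  moreover have "\<Omega> {} \<subseteq> {rt}"
    using Omega_Phi[of _ "{}"] Phi by auto
  ultimately show ?thesis by auto
qed

lemma ip_joint_kernel: "ip (joint_kernel T a) = ip (l2 V)"
  by (simp add: joint_kernel_def Let_def)

lemma vecs_joint_kernel:
  "vecs (joint_kernel T a) = {f \<in> vecs (l2 V). \<forall>j. hilbert_adjoint (l2 V) (multishift T a j) f = 0}"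
  by (simp add: joint_kernel_def Let_def)

lemma L_space_support: "f \<in> L_space T a F u \<Longrightarrow> v \<notin> sib_set T F u \<Longrightarrow> f v = 0"
  by (simp add: L_space_def l2_mem_iff)

lemma L_space_l2:
  assumes "f \<in> L_space T a F u"
  shows "f \<in> vecs (l2 V)"
proof (rule l2_superset)
  show "f \<in> vecs (l2 (sib_set T F u))"
    using assms by (simp add: L_space_def)
  show "sib_set T F u \<subseteq> V"
    by (auto simp: sib_set_def)
qed

lemma zero_mem_L_space: "0 \<in> L_space T a F u"
  by (simp add: L_space_def)

lemma diff_mem_L_space: "f \<in> L_space T a F u \<Longrightarrow> g \<in> L_space T a F u \<Longrightarrow> f - g \<in> L_space T a F u"
  by (simp add: L_space_def left_diff_distrib sum_subtractf)

text \<open>\<open>orth_proj\<close> is a definite description; two candidates coincide because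
  their difference lies in the space and is orthogonal to it.\<close>

lemma orth_proj_eq:
  assumes "p \<in> L_space T a F u" "x \<in> vecs (l2 V)"
    and "\<And>y. y \<in> L_space T a F u \<Longrightarrow> ip (l2 V) (x - p) y = 0"
  shows "orth_proj (joint_kernel T a) (L_space T a F u) x = p"
  unfolding orth_proj_def ip_joint_kernel
proof (rule the_equality)
  fix q assume q: "q \<in> L_space T a F u \<and> (\<forall>y\<in>L_space T a F u. ip (l2 V) (x - q) y = 0)"
  have pq: "p - q \<in> L_space T a F u"
    using assms(1) q diff_mem_L_space by blast
  have "ip (l2 V) ((x - q) - (x - p)) (p - q) = 0"
    using assms q pq L_space_l2 by (subst l2.ip_diff_left) auto
  then have "p - q = 0"
    using l2.ip_self_eq_0[OF L_space_l2[OF pq]] by simp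
  then show "q = p" by simp
qed (use assms in blast)

lemma orth_proj_L_space:
  assumes "x \<in> L_space T a F u" "u \<in> \<Omega> F" "u' \<in> \<Omega> F'"
  shows "orth_proj (joint_kernel T a) (L_space T a F' u') x = (if F' = F \<and> u' = u then x else 0)"
proof (cases "F' = F \<and> u' = u")
  case True
  then show ?thesis
    using assms by (simp add: orth_proj_eq[OF assms(1) L_space_l2[OF assms(1)]] L_space_l2)
next
  case False
  have "ip (l2 V) x y = 0" if y: "y \<in> L_space T a F' u'" for y
  proof -
    have "x v * cnj (y v) = 0" for v
      using Omega_unique[OF assms(2,3), of v] False L_space_support[OF assms(1)] L_space_support[OF y]
      by force
    then show ?thesis
      unfolding ip_l2 by (rule infsum_0)
  qed
  then have "orth_proj (joint_kernel T a) (L_space T a F' u') x = 0"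
    using L_space_l2[OF assms(1)] by (intro orth_proj_eq zero_mem_L_space) auto
  then show ?thesis
    using False by auto
qed

text \<open>Disjoint supports annihilate every projection except the one onto the space containing
  \<open>x\<close>. Both \<open>e_rt\<close> and the vectors produced by branching are fed to the
  kernel in this way.\<close>

lemma tree_kernel_L_space:
  assumes "x \<in> L_space T a F u" "u \<in> \<Omega> F"
  shows "tree_kernel T \<Omega> a z w x = scalar_kernel a (mdepth T u) z w *\<^sub>C x"
proof
  fix v
  have "(\<Sum>\<^sub>\<infinity>u'\<in>\<Omega> F'. scalar_kernel a (mdepth T u') z w *
        orth_proj (joint_kernel T a) (L_space T a F' u') x v)
      = (if F' = F then scalar_kernel a (mdepth T u) z w * x v else 0)" for F'
  proof (cases "F' = F")
    case True
    have "((\<lambda>u'. scalar_kernel a (mdepth T u') z w *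
        orth_proj (joint_kernel T a) (L_space T a F u') x v) has_sum
        scalar_kernel a (mdepth T u) z w * x v) (\<Omega> F)"
      using assms by (intro has_sum_finite_neutralI[of "{u}"]) (auto simp: orth_proj_L_space[OF assms])
    then show ?thesis
      unfolding True by (simp add: infsumI)
  next
    case False
    then show ?thesis
      by (simp add: orth_proj_L_space[OF assms] cong: infsum_cong)
  qed
  then show "tree_kernel T \<Omega> a z w x v = (scalar_kernel a (mdepth T u) z w *\<^sub>C x) v"
    by (simp add: tree_kernel_def)
qed

section \<open>The multishift and its adjoint at explicit vectors\<close>

lemma finite_Chi_at:
  assumes "v \<in> V"
  shows "finite (Chi_at T k v)"
proof (rule finite_subset)
  show "Chi_at T k v \<subseteq> (\<lambda>c. v(k := c)) ` Chi (T k) (v k)"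
  proof
    fix w assume "w \<in> Chi_at T k v"
    then have "w = v(k := w k)" "w k \<in> Chi (T k) (v k)"
      by (auto simp: Chi_at_def)
    then show "w \<in> (\<lambda>c. v(k := c)) ` Chi (T k) (v k)"
      by blast
  qed
  show "finite ((\<lambda>c. v(k := c)) ` Chi (T k) (v k))"
    using assms locally_finite by (simp add: locally_finite_def V_iff)
qed

lemma shift_basis_apply:
  assumes "v \<in> V"
  shows "shift_basis T a k v w = (if w \<in> Chi_at T k v then of_real (weight T a k w) else 0)"
proof -
  have "shift_basis T a k v w = (\<Sum>w'\<in>Chi_at T k v. if w = w' then of_real (weight T a k w') else 0)"
    unfolding shift_basis_def sum_fun_apply by (intro sum.cong) (auto simp: indicator_def)
  then show ?thesis
    using finite_Chi_at[OF assms] by (simp add: sum.delta')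
qed

lemma multishift_root:
  assumes "w k = rt k"
  shows "multishift T a k f w = 0"
proof -
  have "f v * shift_basis T a k v w = 0" if "v \<in> V" for v
    using assms that by (auto simp: shift_basis_apply Chi_at_def Chi_def)
  then show ?thesis
    unfolding multishift_def by (rule infsum_0)
qed

lemma multishift_child:
  assumes "w \<in> V" "(p, w k) \<in> edges (T k)"
  shows "multishift T a k f w = f (w(k := p)) * of_real (weight T a k w)"
proof -
  have p: "w(k := p) \<in> V"
    using assms tree.edge_verts by (auto simp: V_iff)
  have Chi: "w \<in> Chi_at T k v \<longleftrightarrow> v = w(k := p)" if "v \<in> V" for v
    using assms tree.parent_unique that by (auto simp: Chi_at_def Chi_def fun_eq_iff)
  have "((\<lambda>v. f v * shift_basis T a k v w) has_sum f (w(k := p)) * of_real (weight T a k w)) V"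
    using p by (intro has_sum_finite_neutralI[of "{w(k := p)}"]) (auto simp: shift_basis_apply Chi)
  then show ?thesis
    unfolding multishift_def by (rule infsumI)
qed

text \<open>One vector with the adjoint identity certifies the value: its difference from any other
  such vector is orthogonal to itself.\<close>

lemma hilbert_adjoint_eq:
  assumes "h \<in> vecs (l2 X)" "\<And>f. f \<in> vecs (l2 X) \<Longrightarrow> ip (l2 X) (A f) g = ip (l2 X) f h"
  shows "hilbert_adjoint (l2 X) A g = h"
  unfolding hilbert_adjoint_def
proof (rule the_equality)
  fix h' assume h': "h' \<in> vecs (l2 X) \<and> (\<forall>f\<in>vecs (l2 X). ip (l2 X) (A f) g = ip (l2 X) f h')"
  then have "ip (l2 X) (h - h') (h - h') = 0"
    using assms by (subst l2.ip_diff_right) auto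
  then have "h - h' = 0"
    using assms(1) h' by simp
  then show "h' = h" by simp
qed (use assms in blast)

definition e_rt :: "('d \<Rightarrow> 'v) \<Rightarrow> complex" where
  "e_rt v = (if v = rt then 1 else 0)"

lemma e_rt_l2: "e_rt \<in> vecs (l2 V)"
  by (rule l2_finite_support[of "{rt}"]) (auto simp: e_rt_def)

lemma ip_e_rt:
  "ip (l2 V) f e_rt = f rt"
  unfolding ip_l2 by (intro infsumI has_sum_finite_neutralI[of "{rt}"]) (auto simp: e_rt_def)

text \<open>Shifted functions vanish at the root, so each adjoint annihilates its indicator.\<close>

lemma e_rt_joint_kernel: "e_rt \<in> vecs (joint_kernel T a)"
  unfolding vecs_joint_kernel
  using e_rt_l2 by (auto intro!: hilbert_adjoint_eq simp: ip_e_rt multishift_root)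

lemma e_rt_L_space: "e_rt \<in> L_space T a {} rt"
proof -
  have "e_rt \<in> vecs (l2 (sib_set T {} rt))"
    by (rule l2_finite_support[of "{rt}"]) (auto simp: e_rt_def sib_set_def)
  then show ?thesis
    by (simp add: L_space_def)
qed

lemma mdepth_rt: "mdepth T rt = (\<lambda>_. 0)"
  by (simp add: mdepth_def tree.depth_root)

lemma tree_kernel_e_rt: "tree_kernel T \<Omega> a z w e_rt = scalar_kernel a (\<lambda>_. 0) z w *\<^sub>C e_rt"
  using tree_kernel_L_space[OF e_rt_L_space, of z w] by (simp add: Omega_empty mdepth_rt)

text \<open>Two children of \<open>b\<close>, with roots in the other coordinates, have a common
  parent and hence equal weights, so every shifted function takes the same value at both. This gives
  the sum condition of \<open>L_space\<close> as well as the vanishing of the adjoints.\<close>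

lemma branching_kernel_vector:
  assumes b: "b \<in> branching_vertices (T j)"
  obtains y w where "w \<in> \<Omega> {j}" "y \<in> L_space T a {j} w" "y \<in> vecs (joint_kernel T a)" "y \<noteq> 0" "y rt = 0"
proof -
  obtain c1 c2 where c: "c1 \<noteq> c2" "(b, c1) \<in> edges (T j)" "(b, c2) \<in> edges (T j)"
    using b by (auto simp: branching_vertices_def Chi_def)
  define u1 u2 where "u1 = rt(j := c1)" and "u2 = rt(j := c2)"
  have ne: "u1 \<noteq> u2"
  proof
    assume "u1 = u2"
    then have "u1 j = u2 j" by simp
    then show False
      using c(1) by (simp add: u1_def u2_def)
  qed
  have V: "u1 \<in> V" "u2 \<in> V"
    using c tree.edge_verts by (auto simp: u1_def u2_def V_iff)
  have u1: "u1 \<in> Phi T {j}"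
    using V c by (auto simp: Phi_def u1_def)
  \<comment> \<open>The transversal may represent the class by another sibling than
    \<open>u1\<close>. The space is attached to that representative \<open>w\<close>, whose
    coordinate \<open>j\<close> is again a child of \<open>b\<close>.\<close>
  then obtain w where w: "w \<in> \<Omega> {j}" "w \<in> sib_set T {j} u1"
    using transversal unfolding sib_transversal_def by blast
  have sw: "sib_set T {j} w = sib_set T {j} u1"
    using sib_setD(2)[OF u1 w(2)] .
  have wj: "sib (T j) (w j) = Chi (T j) b"
  proof -
    have "sib (T j) (u1 j) = Chi (T j) b"
      using c(2) by (simp add: u1_def tree.sib_eq)
    moreover have "w j \<in> sib (T j) (u1 j)"
      using w(2) by (auto simp: sib_set_def)
    ultimately show ?thesis
      by (simp add: Chi_def tree.sib_eq)
  qed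
  define y where "y v = (if v = u1 then 1 else if v = u2 then -1 else 0 :: complex)" for v
  have u12: "u1 \<in> sib_set T {j} w" "u2 \<in> sib_set T {j} w"
    unfolding sw using V c by (auto simp: sib_set_def u1_def u2_def tree.sib_eq Chi_def)
  have same_weight: "weight T a j u1 = weight T a j u2"
    using c by (simp add: weight_def u1_def u2_def tree.par_eq)
  have sum_y: "(\<Sum>v\<in>S. y v * g v) = g u1 - g u2" if "finite S" "u1 \<in> S" "u2 \<in> S" for S and g :: "_ \<Rightarrow> complex"
  proof -
    have "(\<Sum>v\<in>S. y v * g v) = (\<Sum>v\<in>{u1, u2}. y v * g v)"
      using that by (intro sum.mono_neutral_right) (auto simp: y_def)
    then show ?thesis
      using ne by (simp add: y_def)
  qed
  have "y \<in> L_space T a {j} w"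
    unfolding L_space_def
  proof (intro CollectI conjI ballI)
    show "y \<in> vecs (l2 (sib_set T {j} w))"
      by (rule l2_finite_support[of "{u1, u2}"]) (use u12 in \<open>auto simp: y_def\<close>)
    fix i v assume iv: "i \<in> {j}" "v \<in> restr T ({j} - {i}) ` sib_set T {j} w"
    then have i: "i = j" and v: "v = rt"
      by (auto simp: restr_def)
    have S: "sib_at T j (rt(j := w j)) = {w' \<in> V. (\<forall>i. i \<noteq> j \<longrightarrow> w' i = rt i) \<and> w' j \<in> Chi (T j) b}"
      by (auto simp: sib_at_def wj)
    also have "\<dots> = Chi_at T j (rt(j := b))"
      by (auto simp: Chi_at_def)
    finally have "finite (sib_at T j (rt(j := w j)))"
      using c(2) tree.edge_verts by (auto intro!: finite_Chi_at simp: V_iff)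
    then have "(\<Sum>w'\<in>sib_at T j (rt(j := w j)). y w' * of_real (weight T a j w')) = 0"
      by (subst sum_y) (use V c same_weight in \<open>auto simp: S u1_def u2_def Chi_def\<close>)
    then show "(\<Sum>w'\<in>sib_at T i (v(i := w i)). y w' * of_real (weight T a i w')) = 0"
      by (simp add: i v)
  qed
  moreover have "y \<in> vecs (joint_kernel T a)"
    unfolding vecs_joint_kernel
  proof (intro CollectI conjI allI)
    show "y \<in> vecs (l2 V)"
      using L_space_l2 calculation .
    fix k show "hilbert_adjoint (l2 V) (multishift T a k) y = 0"
    proof (rule hilbert_adjoint_eq)
      fix f assume f: "f \<in> vecs (l2 V)"
      have "ip (l2 V) (multishift T a k f) y = multishift T a k f u1 - multishift T a k f u2"
        unfolding ip_l2 using V ne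
        by (intro infsumI has_sum_finite_neutralI[of "{u1, u2}"]) (auto simp: y_def)
      also have "\<dots> = 0"
      proof (cases "k = j")
        case True
        have "multishift T a j f u1 = multishift T a j f u2"
          using V c same_weight multishift_child[of u1 b j f] multishift_child[of u2 b j f]
          by (simp add: u1_def u2_def)
        then show ?thesis
          using True by simp
      next
        case False
        then show ?thesis
          by (simp add: multishift_root u1_def u2_def)
      qed
      finally show "ip (l2 V) (multishift T a k f) y = ip (l2 V) f 0"
        using f by simp
    qed simp
  qed
  moreover have "y u1 \<noteq> 0"
    by (simp add: y_def)
  then have "y \<noteq> 0" by auto
  moreover have "u1 \<noteq> rt" "u2 \<noteq> rt"
    using c tree.root_not_child by (metis fun_upd_same u1_def, metis fun_upd_same u2_def)
  then have "y rt = 0"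
    by (auto simp: y_def)
  ultimately show ?thesis
    using that w(1) by blast
qed

text \<open>The upper bound rests on \<open>d_k + 1 \<le> |d| + a\<close>, where
  \<open>a > 0\<close> enters, and on a parent having at least one child. In
  \<open>joint_kernel_trivial\<close> it keeps a weighted function square summable, and positivity
  allows the weight to be cancelled.\<close>

lemma weight_bounds:
  assumes "w \<in> V" "(p, w k) \<in> edges (T k)"
  shows "0 < weight T a k w" "weight T a k w \<le> 1"
proof -
  define v where "v = w(k := p)"
  have v: "v \<in> V"
    using assms tree.edge_verts by (auto simp: V_iff v_def)
  have "w \<in> Chi_at T k v"
    using assms by (auto simp: Chi_at_def v_def Chi_def)
  then have card: "1 \<le> card (Chi_at T k v)"
    using finite_Chi_at[OF v, of k] by (simp add: Suc_le_eq card_gt_0_iff) blast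
  have w: "weight T a k w = 1 / sqrt (real (card (Chi_at T k v))) *
      sqrt (real (mdepth T v k + 1) / real ((\<Sum>i\<in>UNIV. mdepth T v i) + a))"
    using assms by (simp add: weight_def Let_def v_def tree.par_eq)
  have "mdepth T v k \<le> (\<Sum>i\<in>UNIV. mdepth T v i)"
    by (rule member_le_sum) auto
  then have le: "mdepth T v k + 1 \<le> (\<Sum>i\<in>UNIV. mdepth T v i) + a"
    using a_pos by linarith
  have bounds: "0 < 1 / sqrt (real c) * sqrt (real m / real n)"
      "1 / sqrt (real c) * sqrt (real m / real n) \<le> 1"
    if "1 \<le> c" "m \<le> n" "0 < m" for c m n
  proof -
    show "0 < 1 / sqrt (real c) * sqrt (real m / real n)"
      using that by auto
    have "sqrt (real m / real n) \<le> 1" "1 / sqrt (real c) \<le> 1"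
      using that by auto
    then show "1 / sqrt (real c) * sqrt (real m / real n) \<le> 1"
      by (intro mult_le_one) auto
  qed
  show "0 < weight T a k w" "weight T a k w \<le> 1"
    unfolding w using bounds[OF card le] by simp_all
qed

text \<open>When each vertex has a single child in direction \<open>k\<close>, the adjoint of the
  shift is a weighted backward shift. Its vanishing at \<open>x\<close> makes \<open>x\<close>
  vanish wherever coordinate \<open>k\<close> is not the root.\<close>

lemma joint_kernel_trivial:
  assumes nb: "\<And>j. branching_vertices (T j) = {}" and x: "x \<in> vecs (joint_kernel T a)"
  shows "x = x rt *\<^sub>C e_rt"
proof
  fix v
  have xl2: "x \<in> vecs (l2 V)"
    using x by (simp add: vecs_joint_kernel)
  consider "v = rt" | "v \<notin> V" | k where "v \<in> V" "v k \<noteq> rt k"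
    by auto
  then show "x v = (x rt *\<^sub>C e_rt) v"
  proof cases
    case 2
    then show ?thesis
      using xl2 by (auto simp: l2_mem_iff e_rt_def)
  next
    case 3
    define nxt where "nxt u = (SOME c. (u, c) \<in> edges (T k))" for u
    have nxt: "(u, nxt u) \<in> edges (T k)" if "u \<in> verts (T k)" for u
      using leafless[of k] that unfolding nxt_def leafless_def Chi_def by (auto intro: someI)
    have nxt_unique: "c = nxt u" if "(u, c) \<in> edges (T k)" for u c
    proof -
      have "u \<in> verts (T k)"
        using tree.edge_verts that by blast
      then show ?thesis
        using nb[of k] nxt[of u] that unfolding branching_vertices_def Chi_def by blast
    qed
    \<comment> \<open>The move to the only child in direction \<open>k\<close>. Taking the parent in
      that coordinate inverts it, so it maps \<open>V\<close> bijectively onto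
      \<open>Vk\<close>.\<close>
    define up where "up u = u(k := nxt (u k))" for u :: "'d \<Rightarrow> 'v"
    define Vk where "Vk = {w \<in> V. w k \<noteq> rt k}"
    have up: "up u \<in> Vk" "(u k, up u k) \<in> edges (T k)" if "u \<in> V" for u
      using that nxt[of "u k"] tree.edge_verts[OF nxt[of "u k"]]
      by (auto simp: up_def Vk_def V_iff dest: tree.root_not_child[THEN notE])
    have down: "w(k := par (T k) (w k)) \<in> V" "up (w(k := par (T k) (w k))) = w"
        "(par (T k) (w k), w k) \<in> edges (T k)" if w: "w \<in> Vk" for w
    proof -
      obtain p where p: "(p, w k) \<in> edges (T k)"
        using w tree.ex_parent[of "w k" k] by (auto simp: Vk_def V_iff)
      then show "w(k := par (T k) (w k)) \<in> V" "up (w(k := par (T k) (w k))) = w"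
        "(par (T k) (w k), w k) \<in> edges (T k)"
        using w tree.edge_verts[OF p] nxt_unique[OF p]
        by (auto simp: Vk_def V_iff tree.par_eq up_def)
    qed
    have down_up: "(up u)(k := par (T k) (up u k)) = u" if "u \<in> V" for u
      using up(2)[OF that] by (simp add: tree.par_eq) (simp add: up_def)
    have bij: "bij_betw up V Vk"
      by (rule bij_betw_byWitness[where f' = "\<lambda>w. w(k := par (T k) (w k))"])
        (use up down down_up in auto)
    \<comment> \<open>The candidate for the adjoint applied to \<open>x\<close>; the value 0 off
      \<open>V\<close> is required for membership in \<open>l2 V\<close>.\<close>
    define h where "h u = (if u \<in> V then of_real (weight T a k (up u)) * x (up u) else 0)" for u
    have "(\<lambda>w. (cmod (x w))\<^sup>2) summable_on Vk"
      using xl2 by (auto simp: l2_mem_iff Vk_def intro: summable_on_subset_banach)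
    then have sum_up: "(\<lambda>u. (cmod (x (up u)))\<^sup>2) summable_on V"
      using summable_on_reindex_bij_betw[OF bij, of "\<lambda>w. (cmod (x w))\<^sup>2"] by simp
    have h: "h \<in> vecs (l2 V)"
      unfolding l2_mem_iff
    proof (intro conjI)
      show "(\<lambda>u. (cmod (h u))\<^sup>2) summable_on V"
      proof (rule summable_on_comparison_test[OF sum_up])
        fix u assume u: "u \<in> V"
        have "up u \<in> V"
          using up(1)[OF u] by (simp add: Vk_def)
        then have "0 < weight T a k (up u)" "weight T a k (up u) \<le> 1"
          using weight_bounds up(2)[OF u] by blast+
        then have "cmod (h u) \<le> cmod (x (up u))"
          using u by (simp add: h_def norm_mult mult_left_le_one_le)
        then show "(cmod (h u))\<^sup>2 \<le> (cmod (x (up u)))\<^sup>2"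
          by (rule power_mono) simp
      qed simp
    qed (simp add: h_def)
    have "hilbert_adjoint (l2 V) (multishift T a k) x = h"
    proof (rule hilbert_adjoint_eq[OF h])
      fix f assume "f \<in> vecs (l2 V)"
      have "ip (l2 V) (multishift T a k f) x = (\<Sum>\<^sub>\<infinity>w\<in>Vk. multishift T a k f w * cnj (x w))"
        unfolding ip_l2 by (rule infsum_cong_neutral) (auto simp: Vk_def multishift_root)
      also have "\<dots> = (\<Sum>\<^sub>\<infinity>u\<in>V. multishift T a k f (up u) * cnj (x (up u)))"
        by (rule infsum_reindex_bij_betw[OF bij, symmetric])
      also have "\<dots> = (\<Sum>\<^sub>\<infinity>u\<in>V. f u * cnj (h u))"
      proof (rule infsum_cong)
        fix u assume u: "u \<in> V"
        have "(up u)(k := u k) = u"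
          by (simp add: up_def)
        then show "multishift T a k f (up u) * cnj (x (up u)) = f u * cnj (h u)"
          using u up[OF u] by (simp add: multishift_child[of "up u" "u k"] Vk_def h_def)
      qed
      finally show "ip (l2 V) (multishift T a k f) x = ip (l2 V) f h"
        by (simp add: ip_l2)
    qed
    then have h0: "h = 0"
      using x by (simp add: vecs_joint_kernel)
    have vk: "v \<in> Vk"
      using 3 by (simp add: Vk_def)
    have "weight T a k v > 0"
      using weight_bounds(1)[OF 3(1) down(3)[OF vk]] .
    moreover have "h (v(k := par (T k) (v k))) = of_real (weight T a k v) * x v"
      using down(1,2)[OF vk] by (simp add: h_def)
    ultimately have "x v = 0"
      using h0 by simp
    then show ?thesis
      using 3 by (auto simp: e_rt_def)
  qed (simp add: e_rt_def)
qed

end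

section \<open>The module of a product of trees\<close>

locale tree_DA_module = tree_product T \<Omega> a + DA_module a HA
  for T :: "'d::finite \<Rightarrow> 'v dgraph" and \<Omega> a
    and HA :: "(complex ^ 'd \<Rightarrow> complex) hilbert" +
  fixes HT :: "(complex ^ 'd \<Rightarrow> ('d \<Rightarrow> 'v) \<Rightarrow> complex) hilbert"
  assumes tree_DA: "is_tree_DA_module T \<Omega> a HT"
begin

sublocale HT: hilbert_structure HT
  using tree_DA by unfold_locales (simp add: is_tree_DA_module_def holomorphic_rkhs_def)

abbreviation tkern :: "complex ^ 'd \<Rightarrow> (('d \<Rightarrow> 'v) \<Rightarrow> complex) \<Rightarrow> complex ^ 'd \<Rightarrow> ('d \<Rightarrow> 'v) \<Rightarrow> complex" where
  "tkern w x \<equiv> ball_fun (\<lambda>z. tree_kernel T \<Omega> a z w x)"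

lemma HT_outside: "f \<in> vecs HT \<Longrightarrow> z \<notin> ball 0 1 \<Longrightarrow> f z = 0"
  using tree_DA unfolding is_tree_DA_module_def holomorphic_rkhs_def
  by (elim conjE) (simp add: zero_fun_def)

lemma HT_value: "f \<in> vecs HT \<Longrightarrow> z \<in> ball 0 1 \<Longrightarrow> f z \<in> vecs (joint_kernel T a)"
  using tree_DA unfolding is_tree_DA_module_def holomorphic_rkhs_def by (elim conjE) (simp)

lemma tkern_mem:
  assumes "w \<in> ball 0 1" "x \<in> vecs (joint_kernel T a)"
  shows "tkern w x \<in> vecs HT"
  using tree_DA assms unfolding is_tree_DA_module_def holomorphic_rkhs_def ball_fun_def
  by (elim conjE) (simp)

lemma ip_tkern:
  assumes "w \<in> ball 0 1" "x \<in> vecs (joint_kernel T a)" "f \<in> vecs HT"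
  shows "ip HT f (tkern w x) = ip (l2 V) (f w) x"
  using tree_DA assms unfolding is_tree_DA_module_def holomorphic_rkhs_def ball_fun_def ip_joint_kernel
  by (elim conjE) (simp)

lemma zero_in_ball: "(0 :: complex ^ 'd) \<in> ball 0 1"
  by simp

text \<open>Pairing with a kernel function at 0 evaluates at 0, where the factor \<open>z_k\<close>
  vanishes. Invariance of \<open>HT\<close> makes \<open>mult_coord k f\<close> a member to which
  the reproducing property applies.\<close>

lemma tkern_0_orthogonal:
  assumes "x \<in> vecs (joint_kernel T a)" "coord_invariant HT" "f \<in> vecs HT"
  shows "ip HT (tkern 0 x) (mult_coord k f) = 0"
proof -
  have mem: "mult_coord k f \<in> vecs HT"
    using assms unfolding coord_invariant_def by blast
  have "mult_coord k f 0 = 0"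
    by (simp add: mult_coord_def)
  then have "ip HT (mult_coord k f) (tkern 0 x) = 0"
    using assms(1) by (simp add: ip_tkern[OF zero_in_ball assms(1) mem] vecs_joint_kernel)
  then show ?thesis
    using HT.ip_commute[OF mem tkern_mem[OF zero_in_ball assms(1)]] by simp
qed

text \<open>A branching vertex produces two orthogonal vectors of the joint kernel. The corresponding
  constant functions are orthogonal to all \<open>z\<^sub>k f\<close>, a property that a module isomorphism
  preserves and that in \<open>HA\<close> holds for a line only.\<close>

lemma not_branching_if_iso:
  assumes "hilbert_module_iso HT HA"
  shows "branching_vertices (T j) = {}"
proof (rule ccontr)
  assume "branching_vertices (T j) \<noteq> {}"
  then obtain b where "b \<in> branching_vertices (T j)" by blast
  then obtain y u where u: "u \<in> \<Omega> {j}" and y: "y \<in> L_space T a {j} u"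
    "y \<in> vecs (joint_kernel T a)" "y \<noteq> 0" "y rt = 0"
    by (rule branching_kernel_vector)
  obtain U where inv: "coord_invariant HT" and U: "unitary_map HT HA U"
    and mult: "\<And>k f. f \<in> vecs HT \<Longrightarrow> U (mult_coord k f) = mult_coord k (U f)"
    using assms unfolding hilbert_module_iso_def by blast
  have UH: "U f \<in> vecs HA" if "f \<in> vecs HT" for f
    using U that unfolding unitary_map_def bij_betw_def by blast
  have Uip: "ip HA (U f) (U g) = ip HT f g" if "f \<in> vecs HT" "g \<in> vecs HT" for f g
    using U that unfolding unitary_map_def by blast
  have orth: "ip HA (U (tkern 0 x)) (mult_coord k h) = 0"
    if x: "x \<in> vecs (joint_kernel T a)" and h: "h \<in> vecs HA" for x k h
  proof -
    obtain f where f: "f \<in> vecs HT" "h = U f"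
      using U h unfolding unitary_map_def bij_betw_def by blast
    have "mult_coord k f \<in> vecs HT"
      using inv f(1) unfolding coord_invariant_def by blast
    then show ?thesis
      using Uip[OF tkern_mem[OF zero_in_ball x]] tkern_0_orthogonal[OF x inv f(1)]
      by (simp add: f(2) mult[OF f(1), symmetric])
  qed
  \<comment> \<open>Reproducing at 0 leaves only the kernel at \<open>(0, 0)\<close>, which fixes
    the two vectors \<open>e_rt\<close> and \<open>y\<close>.\<close>
  have ip0: "ip HA (U (tkern 0 x)) (U (tkern 0 x')) = ip (l2 V) (tree_kernel T \<Omega> a 0 0 x) x'"
    if "x \<in> vecs (joint_kernel T a)" "x' \<in> vecs (joint_kernel T a)" for x x'
    using that
    by (simp add: Uip tkern_mem[OF zero_in_ball] ip_tkern[OF zero_in_ball] del: mem_ball)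
      (simp add: ball_fun_def)
  have k_rt: "tree_kernel T \<Omega> a 0 0 e_rt = e_rt"
    by (simp add: tree_kernel_e_rt scalar_kernel_at_0 scaleC_one)
  have k_y: "tree_kernel T \<Omega> a 0 0 y = y"
    using tree_kernel_L_space[OF y(1) u] by (simp add: scalar_kernel_at_0 scaleC_one)
  have "ip HA (U (tkern 0 y)) (U (tkern 0 e_rt)) = 0"
    using y by (simp add: ip0 e_rt_joint_kernel k_y ip_e_rt)
  then have "U (tkern 0 y) = 0 \<or> U (tkern 0 e_rt) = 0"
    using UH[OF tkern_mem[OF zero_in_ball]] y(2) e_rt_joint_kernel orth
    by (intro orthogonal_to_coord_multiples) auto
  moreover have "ip HA (U (tkern 0 e_rt)) (U (tkern 0 e_rt)) = 1"
    by (simp add: ip0 e_rt_joint_kernel k_rt ip_e_rt) (simp add: e_rt_def)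
  moreover have "ip HA (U (tkern 0 y)) (U (tkern 0 y)) \<noteq> 0"
    using y by (simp add: ip0 k_y vecs_joint_kernel)
  ultimately show False
    by (metis HA.ip_zero_left HA.zero_mem zero_neq_one)
qed

text \<open>With \<open>E\<close> spanned by \<open>e_rt\<close>, an element of \<open>HT\<close> is
  determined by its root coordinate. The families \<open>tkern w e_rt\<close> and
  \<open>kern w\<close> then have equal Gram matrices, and the unitary obtained sends
  \<open>f\<close> to \<open>\<lambda>w. f w rt\<close>.\<close>

lemma iso_if_not_branching:
  assumes nb: "\<And>j. branching_vertices (T j) = {}"
  shows "hilbert_module_iso HT HA"
proof -
  have kernel: "tree_kernel T \<Omega> a z w e_rt = DA_kernel a z w 1 *\<^sub>C e_rt"
    if "z \<in> ball 0 1" "w \<in> ball 0 1" for z w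
    using that by (simp add: tree_kernel_e_rt scalar_kernel_zero del: mem_ball)
  have val: "f z = f z rt *\<^sub>C e_rt" if "f \<in> vecs HT" for f z
  proof (cases "z \<in> ball 0 1")
    case True
    then show ?thesis
      using joint_kernel_trivial[OF nb HT_value[OF that]] by blast
  next
    case False
    then show ?thesis
      using HT_outside[OF that] by simp
  qed
  have ip_rt: "ip HT f (tkern w e_rt) = f w rt" if "f \<in> vecs HT" "w \<in> ball 0 1" for f w
    using ip_tkern[OF that(2) e_rt_joint_kernel that(1)] by (simp add: ip_e_rt)
  have eq: "f = g" if "f \<in> vecs HT" "g \<in> vecs HT" "\<And>z. z \<in> ball 0 1 \<Longrightarrow> f z rt = g z rt" for f g
  proof
    fix z show "f z = g z"
      using val[OF that(1), of z] val[OF that(2), of z] that(3)[of z]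
        HT_outside[OF that(1), of z] HT_outside[OF that(2), of z] by (cases "z \<in> ball 0 1") auto
  qed
  have "equal_gram HT HA (ball 0 1) (\<lambda>w. tkern w e_rt) kern"
  proof unfold_locales
    fix w z :: "complex ^ 'd" assume w: "w \<in> ball 0 1" and z: "z \<in> ball 0 1"
    show "ip HT (tkern w e_rt) (tkern z e_rt) = ip HA (kern w) (kern z)"
      using ip_rt[OF tkern_mem[OF w e_rt_joint_kernel] z] kernel[OF z w] ip_kern_kern[OF w z] z
      by (simp add: ball_fun_def e_rt_def)
  next
    fix f assume f: "f \<in> vecs HT" "\<forall>w\<in>ball 0 1. ip HT f (tkern w e_rt) = 0"
    then show "f = 0"
      by (intro eq) (auto simp: ip_rt simp del: mem_ball)
  qed (use kern_total in \<open>auto simp: kern_mem tkern_mem e_rt_joint_kernel simp del: mem_ball\<close>)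
  then obtain U where U: "unitary_map HT HA U"
    and Uip: "\<And>f w. f \<in> vecs HT \<Longrightarrow> w \<in> ball 0 1 \<Longrightarrow> ip HA (U f) (kern w) = ip HT f (tkern w e_rt)"
    by (rule equal_gram_unitary) blast
  have UH: "U f \<in> vecs HA" if "f \<in> vecs HT" for f
    using U that unfolding unitary_map_def bij_betw_def by blast
  have Uval: "U f w = f w rt" if "f \<in> vecs HT" for f w
  proof (cases "w \<in> ball 0 1")
    case True
    then show ?thesis
      using Uip[OF that True] ip_kern[OF True UH[OF that]] ip_rt[OF that True] by simp
  next
    case False
    then show ?thesis
      using HA_outside[OF UH[OF that] False] HT_outside[OF that False] by simp
  qed
  \<comment> \<open>Invariance is pulled back from \<open>HA\<close>: the preimage of
    \<open>z_k\<close> times \<open>U f\<close> has the root coordinate of \<open>z_k f\<close>,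
    hence equals it.\<close>
  have mult: "mult_coord k f \<in> vecs HT" if f: "f \<in> vecs HT" for k f
  proof -
    have "mult_coord k (U f) \<in> vecs HA"
      using coord_invariant UH[OF f] by (simp add: coord_invariant_def)
    then obtain g where g: "g \<in> vecs HT" "mult_coord k (U f) = U g"
      using U unfolding unitary_map_def bij_betw_def by blast
    have "g z = mult_coord k f z" for z
    proof -
      have "g z rt = z $ k * f z rt"
        using fun_cong[OF g(2), of z] by (simp add: Uval f g(1) mult_coord_def)
      then have "g z = (z $ k * f z rt) *\<^sub>C e_rt"
        using val[OF g(1), of z] by simp
      also have "\<dots> = z $ k *\<^sub>C f z"
        by (subst (2) val[OF f, of z]) (simp add: scaleC_scaleC)
      finally show ?thesis
        by (simp add: mult_coord_def)
    qed
    then have "g = mult_coord k f" by auto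
    then show ?thesis
      using g(1) by simp
  qed
  have "U (mult_coord k f) = mult_coord k (U f)" if "f \<in> vecs HT" for k f
    unfolding fun_eq_iff Uval[OF mult[OF that]] by (simp add: mult_coord_def Uval[OF that])
  then show ?thesis
    unfolding hilbert_module_iso_def
    using U mult coord_invariant by (auto simp: coord_invariant_def)
qed

end

theorem corollary1p6:
  fixes T :: "'d::finite \<Rightarrow> 'v dgraph"
    and \<Omega> :: "'d set \<Rightarrow> ('d \<Rightarrow> 'v) set"
    and a :: nat
    and HT :: "(complex ^ 'd \<Rightarrow> ('d \<Rightarrow> 'v) \<Rightarrow> complex) hilbert"
    and HA :: "(complex ^ 'd \<Rightarrow> complex) hilbert"
  assumes "a > 0"
    and "\<And>j. rooted_directed_tree (T j)"
    and "\<And>j. countable (verts (T j))"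
    and "\<And>j. infinite (verts (T j))"
    and "\<And>j. leafless (T j)"
    and "\<And>j. locally_finite (T j)"
    and "finite_joint_branching_index T"
    and "sib_transversal T \<Omega>"
    and "is_tree_DA_module T \<Omega> a HT"
    and "is_DA_module a HA"
  shows "hilbert_module_iso HT HA \<longleftrightarrow> (\<forall>j. dgraph_iso (T j) nat_tree)"
proof -
  interpret tree_DA_module T \<Omega> a HA HT
    by unfold_locales (use assms in auto)
  show ?thesis
    using not_branching_if_iso iso_if_not_branching tree.iso_nat_tree_if_not_branching[OF leafless]
      tree.not_branching_if_iso_nat_tree by blast
qed

end
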